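(* Let $G=(V,E)$ be a connected, loopless and bridgeless graph with $n$ vertices and $m$ edges, and write its Tutte polynomial as $T(G;x,y)=\sum_{i,j} t_{i,j}x^iy^j$. Let $s(G)$ be the number of series classes of $G$, $s^*(G)$ the number of non-trivial series classes of $G$, and $\Theta(G)$ the number of $\Theta$ classes of $G$. Then \begin{enumerate} \item $t_{0,m-n+1}=1$; \item $t_{0,m-n}=n+s(G)-m-1$; \item $t_{0,m-n-1}=\binom{m-n+1}{2}-(m-n)\,s(G)+\binom{s(G)}{2}-\Theta(G)$; \item $t_{1,m-n}=s^*(G)$; \item $t_{1,m-n-1}=-s^*(G)(m-n)+\sum_{A} s(G-A)+\Theta(G)$, where the sum runs over all non-trivial series classes $A\subseteq E$ of $G$. \end{enumerate}
   Context: Graphs are finite and may have parallel edges. The Tutte polynomial is $T(G;x,y)=\sum_{A\subseteq E}(x-1)^{\rho(E)-\rho(A)}(y-1)^{\gamma(A)}$, where for $A\subseteq E$, $c(A)$ is the number of connected components of the spanning subgraph $(V,A)$, $\rho(A)=|V|-c(A)$ and $\gamma(A)=|A|-|V|+c(A)$. For $C\subseteq E$, $G-C$ denotes the graph obtained by deleting the edges of $C$ (keeping all vertices), and $G/C$ the graph obtained by contracting the edges of $C$. A series class of a connected bridgeless loopless graph $G$ is a maximal subset $C\subseteq E$ such that removing any two edges of $C$ increases the number of connected components; equivalently, $C$ is a series class iff $G-C$ has exactly $|C|$ connected components and $G-C$ is bridgeless. Series classes partition $E$. A series class is trivial if it has exactly one edge, non-trivial otherwise. If a bridgeless loopless graph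 is disconnected, its series classes are the union of the series classes of its connected components (so $s(G-A)$ is the total number of series classes over all components of $G-A$). For integers $k_1,k_2,k_3\ge1$, $\Theta_{k_1,k_2,k_3}$ is the graph consisting of two vertices $u,v$ joined by three internally disjoint paths of lengths $k_1,k_2,k_3$. A subset $C\subseteq E$ with $|C|=k_1+k_2+k_3$ is a $\Theta$ class of $G$ if $G-C$ is the disjoint union of exactly $k_1+k_2+k_3-1$ connected bridgeless graphs $G_1,\dots,G_{k_1+k_2+k_3-1}$ and the graph obtained from $G$ by contracting each $G_i$ to a single vertex (i.e. $G/(E\setminus C)$) is isomorphic to $\Theta_{k_1,k_2,k_3}$, the edges of $C$ forming the three paths. *)

theory Defs
  imports "HOL-Computational_Algebra.Polynomial"
begin

text \<open>A finite multigraph is given by a vertex set V, an edge set E and an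
endpoint map ends; ends e is the set of the one (loop) or two endpoints of e.
Parallel edges are allowed (different edges may have the same ends).\<close>

definition multigraph :: "'v set \<Rightarrow> 'e set \<Rightarrow> ('e \<Rightarrow> 'v set) \<Rightarrow> bool" where
  "multigraph V E ends \<longleftrightarrow> finite V \<and> finite E \<and>
     (\<forall>e\<in>E. ends e \<subseteq> V \<and> 1 \<le> card (ends e) \<and> card (ends e) \<le> 2)"

definition loopless :: "'e set \<Rightarrow> ('e \<Rightarrow> 'v set) \<Rightarrow> bool" where
  "loopless E ends \<longleftrightarrow> (\<forall>e\<in>E. card (ends e) = 2)"

definition edge_rel :: "('e \<Rightarrow> 'v set) \<Rightarrow> 'e set \<Rightarrow> ('v \<times> 'v) set" where
  "edge_rel ends A = {(u, w). \<exists>e\<in>A. ends e = {u, w}}"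

definition conn :: "'v set \<Rightarrow> ('e \<Rightarrow> 'v set) \<Rightarrow> 'e set \<Rightarrow> ('v \<times> 'v) set" where
  "conn V ends A = (edge_rel ends A)\<^sup>* \<inter> (V \<times> V)"

definition ncomp :: "'v set \<Rightarrow> ('e \<Rightarrow> 'v set) \<Rightarrow> 'e set \<Rightarrow> nat" where
  "ncomp V ends A = card (V // conn V ends A)"

definition connected_graph :: "'v set \<Rightarrow> 'e set \<Rightarrow> ('e \<Rightarrow> 'v set) \<Rightarrow> bool" where
  "connected_graph V E ends \<longleftrightarrow> ncomp V ends E = 1"

definition bridgeless :: "'v set \<Rightarrow> 'e set \<Rightarrow> ('e \<Rightarrow> 'v set) \<Rightarrow> bool" where
  "bridgeless V E ends \<longleftrightarrow> (\<forall>e\<in>E. ncomp V ends (E - {e}) = ncomp V ends E)"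

definition grank :: "'v set \<Rightarrow> ('e \<Rightarrow> 'v set) \<Rightarrow> 'e set \<Rightarrow> nat" where
  "grank V ends A = card V - ncomp V ends A"

definition gnullity :: "'v set \<Rightarrow> ('e \<Rightarrow> 'v set) \<Rightarrow> 'e set \<Rightarrow> nat" where
  "gnullity V ends A = card A + ncomp V ends A - card V"

text \<open>Tutte polynomial as a bivariate integer polynomial, represented as a
polynomial in y whose coefficients are polynomials in x.\<close>
definition tutte :: "'v set \<Rightarrow> 'e set \<Rightarrow> ('e \<Rightarrow> 'v set) \<Rightarrow> int poly poly" where
  "tutte V E ends =
     (\<Sum>A\<in>Pow E. [:[:-1, 1:]:] ^ (grank V ends E - grank V ends A)
                 * [:[:-1:], 1:] ^ (gnullity V ends A))"

definition tcoef :: "int poly poly \<Rightarrow> int \<Rightarrow> int \<Rightarrow> int" where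
  "tcoef T i j = (if i < 0 \<or> j < 0 then 0 else coeff (coeff T (nat j)) (nat i))"

definition series_set :: "'v set \<Rightarrow> 'e set \<Rightarrow> ('e \<Rightarrow> 'v set) \<Rightarrow> 'e set \<Rightarrow> bool" where
  "series_set V E ends C \<longleftrightarrow> C \<subseteq> E \<and>
     (\<forall>e\<in>C. \<forall>f\<in>C. e \<noteq> f \<longrightarrow> ncomp V ends (E - {e, f}) > ncomp V ends E)"

definition series_class :: "'v set \<Rightarrow> 'e set \<Rightarrow> ('e \<Rightarrow> 'v set) \<Rightarrow> 'e set \<Rightarrow> bool" where
  "series_class V E ends C \<longleftrightarrow> C \<noteq> {} \<and> series_set V E ends C \<and>
     (\<forall>D. series_set V E ends D \<and> C \<subseteq> D \<longrightarrow> D = C)"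

definition num_series :: "'v set \<Rightarrow> 'e set \<Rightarrow> ('e \<Rightarrow> 'v set) \<Rightarrow> nat" where
  "num_series V E ends = card {C. series_class V E ends C}"

definition num_nontriv_series :: "'v set \<Rightarrow> 'e set \<Rightarrow> ('e \<Rightarrow> 'v set) \<Rightarrow> nat" where
  "num_nontriv_series V E ends = card {C. series_class V E ends C \<and> card C \<ge> 2}"

definition graph_iso ::
  "'v set \<Rightarrow> 'e set \<Rightarrow> ('e \<Rightarrow> 'v set) \<Rightarrow> 'w set \<Rightarrow> 'f set \<Rightarrow> ('f \<Rightarrow> 'w set) \<Rightarrow> bool" where
  "graph_iso V1 E1 ends1 V2 E2 ends2 \<longleftrightarrow>
     (\<exists>\<phi> \<psi>. bij_betw \<phi> V1 V2 \<and> bij_betw \<psi> E1 E2 \<and>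
        (\<forall>e\<in>E1. ends2 (\<psi> e) = \<phi> ` ends1 e))"

text \<open>The theta graph Theta_{k1,k2,k3}: vertices u = (0,0), v = (0,1) and the inner
vertices (i,j), 1 \<le> j < k_i, of path i; path i consists of the edges (i,j),
1 \<le> j \<le> k_i, where edge (i,j) joins the (j-1)-th and j-th vertex of path i.\<close>
definition theta_len :: "nat \<Rightarrow> nat \<Rightarrow> nat \<Rightarrow> nat \<Rightarrow> nat" where
  "theta_len k1 k2 k3 i = (if i = 1 then k1 else if i = 2 then k2 else k3)"

definition theta_pos :: "nat \<Rightarrow> nat \<Rightarrow> nat \<Rightarrow> nat \<Rightarrow> nat \<Rightarrow> nat \<times> nat" where
  "theta_pos k1 k2 k3 i j =
     (if j = 0 then (0, 0) else if j = theta_len k1 k2 k3 i then (0, 1) else (i, j))"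

definition theta_V :: "nat \<Rightarrow> nat \<Rightarrow> nat \<Rightarrow> (nat \<times> nat) set" where
  "theta_V k1 k2 k3 = {(0, 0), (0, 1)} \<union>
     {(i, j). i \<in> {1, 2, 3} \<and> 1 \<le> j \<and> j < theta_len k1 k2 k3 i}"

definition theta_E :: "nat \<Rightarrow> nat \<Rightarrow> nat \<Rightarrow> (nat \<times> nat) set" where
  "theta_E k1 k2 k3 = {(i, j). i \<in> {1, 2, 3} \<and> 1 \<le> j \<and> j \<le> theta_len k1 k2 k3 i}"

definition theta_ends :: "nat \<Rightarrow> nat \<Rightarrow> nat \<Rightarrow> nat \<times> nat \<Rightarrow> (nat \<times> nat) set" where
  "theta_ends k1 k2 k3 ij =
     {theta_pos k1 k2 k3 (fst ij) (snd ij - 1), theta_pos k1 k2 k3 (fst ij) (snd ij)}"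

text \<open>G/(E - C): vertices are the components of G - C, edges are those of C.\<close>
definition contract_V :: "'v set \<Rightarrow> 'e set \<Rightarrow> ('e \<Rightarrow> 'v set) \<Rightarrow> 'e set \<Rightarrow> 'v set set" where
  "contract_V V E ends C = V // conn V ends (E - C)"

definition contract_ends :: "'v set \<Rightarrow> 'e set \<Rightarrow> ('e \<Rightarrow> 'v set) \<Rightarrow> 'e set \<Rightarrow> 'e \<Rightarrow> 'v set set" where
  "contract_ends V E ends C e = (\<lambda>v. conn V ends (E - C) `` {v}) ` ends e"

text \<open>Theta classes. G - C being a disjoint union of connected bridgeless graphs
means that its components are bridgeless, i.e. G - C is bridgeless.\<close>
definition theta_class :: "'v set \<Rightarrow> 'e set \<Rightarrow> ('e \<Rightarrow> 'v set) \<Rightarrow> 'e set \<Rightarrow> bool" where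
  "theta_class V E ends C \<longleftrightarrow> C \<subseteq> E \<and>
     (\<exists>k1 k2 k3. 1 \<le> k1 \<and> 1 \<le> k2 \<and> 1 \<le> k3 \<and> card C = k1 + k2 + k3 \<and>
        ncomp V ends (E - C) = k1 + k2 + k3 - 1 \<and>
        bridgeless V (E - C) ends \<and>
        graph_iso (contract_V V E ends C) C (contract_ends V E ends C)
                  (theta_V k1 k2 k3) (theta_E k1 k2 k3) (theta_ends k1 k2 k3))"

definition num_theta :: "'v set \<Rightarrow> 'e set \<Rightarrow> ('e \<Rightarrow> 'v set) \<Rightarrow> nat" where
  "num_theta V E ends = card {C. theta_class V E ends C}"

end

theory Submission
  imports Defs
begin

text \<open>Let \<open>r C = card C + ncomp E - ncomp (E - C)\<close> be the rank function of the cographic matroid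
  of \<open>G\<close> and \<open>R = m - n + 1\<close> its rank. Substituting \<open>A = E - C\<close>, the Tutte polynomial becomes the sum of
  \<open>(x - 1) ^ (card C - r C) * (y - 1) ^ (R - r C)\<close> over all \<open>C \<subseteq> E\<close>, so that the coefficients of
  \<open>y ^ R\<close>, \<open>y ^ (R - 1)\<close> and \<open>y ^ (R - 2)\<close> only involve sets of rank at most two, which are grouped
  by the flat they span. The points (rank-one flats) are the series classes. A line (rank-two flat)
  has two or three points because the matroid is binary, and the lines with three points are the
  theta classes: contracting the complement of such a line leaves a connected bridgeless graph of
  nullity two, and suppressing its vertices of degree two one by one leads to three parallel edges.
  Finally, the lines through a point \<open>A\<close> correspond to the series classes of \<open>G - A\<close>.\<close>

section \<open>Flats of rank one and two\<close>

text \<open>The counts come from cancellation. The coefficients of x^0 and x^1 in (x - 1)^k are, up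
  to sign, 1 and k, so only sums of (-1)^|C| and of |C| (-1)^|C| over the sets of a given rank in a
  flat are needed. Over a full power set the first sum vanishes unless the set is empty, and the
  second unless it is a singleton. Restricting to the right rank takes away the empty set and, on a
  line, the subsets of its points. What survives is the number of points in the first sum and the
  number of one-element points in the second; this is why the coefficients of x distinguish trivial
  from non-trivial series classes. A line with k points thus enters through k - 1, which is linear
  in k, whereas pairs of points are counted by a binomial coefficient. For k = 2 the two agree, for
  k = 3 they differ by one, and this difference is the origin of the theta terms. Larger k would
  spoil the formulas, so the bound of three points per line is indispensable; it is the place where
  a property of graphs beyond the matroid axioms is used.\<close>

lemma sum_Pow_insert:
  fixes g :: "'a set \<Rightarrow> int"
  assumes "finite F" "x \<notin> F"
  shows "(\<Sum>C\<in>Pow (insert x F). g C) = (\<Sum>C\<in>Pow F. g C + g (insert x C))"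
proof -
  have inj: "inj_on (insert x) (Pow F)"
    using assms(2) by (auto simp: inj_on_def)
  have "(\<Sum>C\<in>Pow (insert x F). g C) = (\<Sum>C\<in>Pow F. g C) + (\<Sum>C\<in>insert x ` Pow F. g C)"
    unfolding Pow_insert by (rule sum.union_disjoint) (use assms in auto)
  also have "(\<Sum>C\<in>insert x ` Pow F. g C) = (\<Sum>C\<in>Pow F. g (insert x C))"
    by (simp add: sum.reindex[OF inj])
  finally show ?thesis by (simp add: sum.distrib)
qed

lemma sum_Pow_alternating:
  assumes "finite F"
  shows "(\<Sum>C\<in>Pow F. (-1) ^ card C) = (if F = {} then 1 else 0 :: int)"
  using assms
proof (induction F rule: finite_induct)
  case (insert x F)
  have "(\<Sum>C\<in>Pow F. (-1) ^ card C + (-1) ^ card (insert x C)) = (0::int)"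
  proof (rule sum.neutral, rule ballI)
    fix C assume "C \<in> Pow F"
    then have "finite C" "x \<notin> C" using insert.hyps finite_subset by auto
    then show "(-1) ^ card C + (-1) ^ card (insert x C) = (0::int)" by simp
  qed
  then show ?case using insert.hyps by (simp add: sum_Pow_insert del: Pow_insert)
qed simp

text \<open>Pairing \<open>C\<close> with \<open>insert x C\<close> leaves minus the plain
  alternating sum over the remaining elements, which vanishes unless nothing remains.\<close>

lemma sum_Pow_alternating_card:
  assumes "finite F"
  shows "(\<Sum>C\<in>Pow F. int (card C) * (-1) ^ card C) = (if card F = 1 then -1 else 0)"
  using assms
proof (induction F rule: finite_induct)
  case (insert x F)
  have "(\<Sum>C\<in>Pow F. int (card C) * (-1) ^ card C + int (card (insert x C)) * (-1) ^ card (insert x C))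
      = (\<Sum>C\<in>Pow F. - ((-1) ^ card C))"
  proof (rule sum.cong)
    fix C assume "C \<in> Pow F"
    then have "finite C" "x \<notin> C" using insert.hyps finite_subset by auto
    then show "int (card C) * (-1) ^ card C + int (card (insert x C)) * (-1) ^ card (insert x C)
        = - ((-1) ^ card C)" by (simp add: algebra_simps)
  qed simp
  then show ?case using insert.hyps
    by (simp add: sum_Pow_insert sum_negf sum_Pow_alternating del: Pow_insert)
qed simp

lemma coeff_x_minus_1_power_0: "coeff ([:-1, 1:] ^ k) 0 = (-1 :: int) ^ k"
  by (induction k) (auto simp: coeff_mult)

lemma coeff_x_minus_1_power_1: "coeff ([:-1, 1:] ^ k) 1 = - int k * (-1) ^ k"
proof (induction k)
  case (Suc k)
  have "coeff ([:-1, 1 :: int:] ^ Suc k) 1 = coeff ([:-1, 1:] ^ k) 0 - coeff ([:-1, 1:] ^ k) 1"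
    by (simp add: coeff_pCons)
  then show ?case using Suc by (simp add: coeff_x_minus_1_power_0 algebra_simps)
qed simp

lemma minus_one_power_diff: "i \<le> c \<Longrightarrow> (-1 :: int) ^ (c - i) = (-1) ^ i * (-1) ^ c"
  using minus_one_mult_self[of i, where ?'a = int] power_add[of "-1::int" "c - i" i]
  by (simp add: algebra_simps)

text \<open>\<open>rank_insert_eq_mono\<close> stands in for submodularity: an element spanned by a
  set is spanned by every larger set. Axioms about a single insertion can be checked in a graph by
  deleting one edge at a time.\<close>

locale loopless_matroid =
  fixes E :: "'e set" and r :: "'e set \<Rightarrow> nat"
  assumes finite_ground: "finite E"
    and rank_empty: "r {} = 0"
    and rank_singleton: "e \<in> E \<Longrightarrow> r {e} = 1"
    and rank_insert_ge: "C \<subseteq> E \<Longrightarrow> e \<in> E \<Longrightarrow> r C \<le> r (insert e C)"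
    and rank_insert_le: "C \<subseteq> E \<Longrightarrow> e \<in> E \<Longrightarrow> r (insert e C) \<le> Suc (r C)"
    and rank_insert_eq_mono:
      "C \<subseteq> D \<Longrightarrow> D \<subseteq> E \<Longrightarrow> e \<in> E \<Longrightarrow> r (insert e C) = r C \<Longrightarrow> r (insert e D) = r D"
begin

section \<open>Closures, flats and points\<close>

definition flat :: "nat \<Rightarrow> 'e set \<Rightarrow> bool" where
  "flat k F \<longleftrightarrow> F \<subseteq> E \<and> r F = k \<and> (\<forall>e\<in>E - F. r (insert e F) \<noteq> r F)"

definition cl :: "'e set \<Rightarrow> 'e set" where
  "cl C = {e \<in> E. r (insert e C) = r C}"

definition points :: "'e set \<Rightarrow> 'e set set" where
  "points F = {P. flat 1 P \<and> P \<subseteq> F}"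

lemma flat_subset: "flat k F \<Longrightarrow> F \<subseteq> E"
  and flat_rank: "flat k F \<Longrightarrow> r F = k"
  by (simp_all add: flat_def)

lemma finite_sub: "C \<subseteq> E \<Longrightarrow> finite C"
  using finite_ground finite_subset by blast

lemma finite_flats [simp]: "finite {F. flat k F \<and> Q F}"
  by (rule finite_subset[of _ "Pow E"]) (auto simp: flat_def finite_ground)

lemma finite_flats' [simp]: "finite {F. flat k F}"
  by (rule finite_subset[of _ "Pow E"]) (auto simp: flat_def finite_ground)

lemma finite_points [simp]: "finite (points F)"
  by (simp add: points_def)

lemma rank_mono:
  assumes "C \<subseteq> D" "D \<subseteq> E"
  shows "r C \<le> r D"
proof -
  have "C \<union> X \<subseteq> E \<longrightarrow> r C \<le> r (C \<union> X)" if "finite X" for X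
    using that
  proof (induction X rule: finite_induct)
    case (insert x X)
    then show ?case using rank_insert_ge[of "C \<union> X" x] by auto
  qed simp
  from this[of D] show ?thesis using assms finite_sub[of D] by (simp add: Un_absorb1)
qed

text \<open>Insert the elements of \<open>D\<close> one at a time: by
  \<open>rank_insert_eq_mono\<close> each of them stays spanned as the set grows.\<close>

lemma rank_Un_eq:
  assumes "C \<subseteq> E" "D \<subseteq> E" "\<forall>e\<in>D. r (insert e C) = r C"
  shows "r (C \<union> D) = r C"
proof -
  have "X \<subseteq> D \<longrightarrow> r (C \<union> X) = r C" if "finite X" for X
    using that
  proof (induction X rule: finite_induct)
    case (insert x X)
    show ?case
    proof
      assume X: "insert x X \<subseteq> D"
      then have "r (insert x (C \<union> X)) = r (C \<union> X)"
        using assms by (intro rank_insert_eq_mono[of C "C \<union> X" x]) auto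
      then show "r (C \<union> insert x X) = r C" using insert.IH X by simp
    qed
  qed simp
  from this[of D] show ?thesis using assms finite_sub[of D] by simp
qed

lemma cl_subset: "cl C \<subseteq> E"
  by (auto simp: cl_def)

lemma subset_cl: "C \<subseteq> E \<Longrightarrow> C \<subseteq> cl C"
  by (auto simp: cl_def insert_absorb)

lemma rank_cl:
  assumes "C \<subseteq> E"
  shows "r (cl C) = r C"
proof -
  have "r (C \<union> cl C) = r C"
    using assms cl_subset by (intro rank_Un_eq) (auto simp: cl_def)
  then show ?thesis using subset_cl[OF assms] by (simp add: Un_absorb1)
qed

lemma cl_mono_flat:
  assumes "flat k F" "C \<subseteq> F"
  shows "cl C \<subseteq> F"
proof
  fix e assume e: "e \<in> cl C"
  then have "r (insert e F) = r F"
    using assms rank_insert_eq_mono[of C F e] flat_subset[of k F] by (auto simp: cl_def)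
  then show "e \<in> F" using assms(1) e by (auto simp: flat_def cl_def)
qed

lemma flat_cl:
  assumes "C \<subseteq> E"
  shows "flat (r C) (cl C)"
  unfolding flat_def
proof (intro conjI ballI notI)
  fix e assume e: "e \<in> E - cl C" and eq: "r (insert e (cl C)) = r (cl C)"
  have "r (insert e C) \<le> r (insert e (cl C))"
    using e cl_subset[of C] subset_cl[OF assms] by (intro rank_mono) auto
  then have "r (insert e C) = r C"
    using eq rank_cl[OF assms] rank_insert_ge[OF assms, of e] e by auto
  then show False using e by (simp add: cl_def)
qed (use assms cl_subset rank_cl in auto)

lemma flat_eq_cl:
  assumes "flat k F" "C \<subseteq> F" "r C = k"
  shows "F = cl C"
proof
  show "F \<subseteq> cl C"
  proof
    fix e assume e: "e \<in> F"
    have F: "F \<subseteq> E" using assms(1) flat_subset by blast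
    have "C \<subseteq> E" "e \<in> E" using e F assms(2) by auto
    have "r (insert e C) \<le> k"
      using rank_mono[of "insert e C" F] e assms F flat_rank[OF assms(1)] by auto
    then show "e \<in> cl C"
      using rank_insert_ge[of C e] assms(3) \<open>C \<subseteq> E\<close> \<open>e \<in> E\<close> by (auto simp: cl_def)
  qed
qed (rule cl_mono_flat[OF assms(1,2)])

lemma flat_unique:
  "flat k F \<Longrightarrow> flat k F' \<Longrightarrow> C \<subseteq> F \<Longrightarrow> C \<subseteq> F' \<Longrightarrow> r C = k \<Longrightarrow> F = F'"
  using flat_eq_cl[of k F C] flat_eq_cl[of k F' C] by simp

text \<open>The closure of a set of rank \<open>k\<close> is the only flat of rank \<open>k\<close>
  that contains it, so these flats partition the sets of rank \<open>k\<close>.\<close>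

lemma sum_by_flats:
  fixes g :: "'e set \<Rightarrow> int"
  shows "(\<Sum>C | C \<subseteq> E \<and> r C = k. g C)
       = (\<Sum>F | flat k F. \<Sum>C | C \<subseteq> F \<and> r C = k. g C)"
proof -
  have eq: "{C. C \<subseteq> E \<and> r C = k} = (\<Union>F\<in>{F. flat k F}. {C. C \<subseteq> F \<and> r C = k})"
  proof (intro set_eqI iffI)
    fix C assume "C \<in> {C. C \<subseteq> E \<and> r C = k}"
    then show "C \<in> (\<Union>F\<in>{F. flat k F}. {C. C \<subseteq> F \<and> r C = k})"
      using flat_cl[of C] subset_cl[of C] by auto
  qed (auto dest: flat_subset)
  show ?thesis unfolding eq
  proof (rule sum.UNION_disjoint)
    show "\<forall>i\<in>{F. flat k F}. finite {C. C \<subseteq> i \<and> r C = k}"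
      using finite_sub flat_subset by (auto intro: finite_subset[of _ "Pow _"])
    show "\<forall>i\<in>{F. flat k F}. \<forall>j\<in>{F. flat k F}. i \<noteq> j \<longrightarrow>
        {C. C \<subseteq> i \<and> r C = k} \<inter> {C. C \<subseteq> j \<and> r C = k} = {}"
      by (simp add: disjoint_iff) (metis flat_unique)
  qed simp
qed

lemma rank_eq_0_iff: "C \<subseteq> E \<Longrightarrow> r C = 0 \<longleftrightarrow> C = {}"
proof
  assume C: "C \<subseteq> E" and 0: "r C = 0"
  show "C = {}"
  proof (rule equals0I)
    fix e assume "e \<in> C"
    then show False using rank_mono[of "{e}" C] rank_singleton[of e] C 0 by auto
  qed
qed (simp add: rank_empty)

lemma flat_1_nonempty: "flat 1 P \<Longrightarrow> P \<noteq> {}"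
  using rank_empty by (auto simp: flat_def)

lemma rank_1_iff_of_flat_1:
  assumes "flat 1 P" "C \<subseteq> P"
  shows "r C = 1 \<longleftrightarrow> C \<noteq> {}"
proof -
  have "P \<subseteq> E" "r P = 1" using assms flat_rank flat_subset by auto
  then have "C \<subseteq> E" "r C \<le> 1" using assms rank_mono[of C P] by auto
  then show ?thesis using rank_eq_0_iff[of C] by auto
qed

section \<open>Sums over a point or a line\<close>

lemma sum_flat_1:
  fixes g :: "'e set \<Rightarrow> int"
  assumes "flat 1 P"
  shows "(\<Sum>C | C \<subseteq> P \<and> r C = 1. g C) = (\<Sum>C\<in>Pow P. g C) - g {}"
proof -
  have eq: "{C. C \<subseteq> P \<and> r C = 1} = Pow P - {{}}"
    using rank_1_iff_of_flat_1[OF assms] by auto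
  show ?thesis unfolding eq
    using finite_sub[OF flat_subset[OF assms]] by (simp add: sum_diff1)
qed

lemma sum_rank_1_in_flat:
  fixes g :: "'e set \<Rightarrow> int"
  assumes "flat k F"
  shows "(\<Sum>C | C \<subseteq> F \<and> r C = 1. g C) = (\<Sum>P\<in>points F. \<Sum>C | C \<subseteq> P \<and> r C = 1. g C)"
proof -
  have eq: "{C. C \<subseteq> F \<and> r C = 1} = (\<Union>P\<in>points F. {C. C \<subseteq> P \<and> r C = 1})"
  proof (intro set_eqI iffI)
    fix C assume "C \<in> {C. C \<subseteq> F \<and> r C = 1}"
    then have "C \<subseteq> F" "r C = 1" "C \<subseteq> E" using flat_subset[OF assms] by auto
    then have "cl C \<in> points F" "C \<subseteq> cl C"
      using flat_cl[of C] cl_mono_flat[OF assms, of C] subset_cl[of C] by (auto simp: points_def)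
    then show "C \<in> (\<Union>P\<in>points F. {C. C \<subseteq> P \<and> r C = 1})" using \<open>r C = 1\<close> by auto
  qed (auto simp: points_def)
  show ?thesis unfolding eq
  proof (rule sum.UNION_disjoint)
    show "\<forall>i\<in>points F. finite {C. C \<subseteq> i \<and> r C = 1}"
      using finite_sub flat_subset by (auto simp: points_def intro: finite_subset[of _ "Pow _"])
    show "\<forall>i\<in>points F. \<forall>j\<in>points F. i \<noteq> j \<longrightarrow>
        {C. C \<subseteq> i \<and> r C = 1} \<inter> {C. C \<subseteq> j \<and> r C = 1} = {}"
      by (simp add: points_def disjoint_iff) (metis One_nat_def flat_unique)
  qed simp
qed

text \<open>Removing the empty set and the nonempty subsets of the points from the power set of a
  line leaves exactly the sets of rank two. Only sums over full power sets remain, and for these the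
  alternating sums are known.\<close>

lemma sum_flat_2:
  fixes g :: "'e set \<Rightarrow> int"
  assumes "flat 2 F"
  shows "(\<Sum>C | C \<subseteq> F \<and> r C = 2. g C)
       = (\<Sum>C\<in>Pow F. g C) - g {} - (\<Sum>P\<in>points F. (\<Sum>C\<in>Pow P. g C) - g {})"
proof -
  have F: "F \<subseteq> E" "finite F" using finite_sub flat_subset[OF assms] by auto
  have le: "r C \<le> 2" if "C \<subseteq> F" for C
    using rank_mono[OF that F(1)] flat_rank[OF assms] by simp
  have eq: "Pow F = insert {} ({C. C \<subseteq> F \<and> r C = 1} \<union> {C. C \<subseteq> F \<and> r C = 2})"
  proof -
    have "C = {} \<or> r C = 1 \<or> r C = 2" if "C \<subseteq> F" for C
      using le[OF that] rank_eq_0_iff[of C] that F by (cases "r C = 0") auto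
    then show ?thesis by auto
  qed
  have fin: "finite {C. C \<subseteq> F \<and> r C = i}" for i
    using F by (auto intro: finite_subset[of _ "Pow F"])
  have "(\<Sum>C\<in>Pow F. g C) = g {} + (\<Sum>C\<in>{C. C \<subseteq> F \<and> r C = 1} \<union> {C. C \<subseteq> F \<and> r C = 2}. g C)"
    unfolding eq by (subst sum.insert) (use fin rank_empty in auto)
  also have "(\<Sum>C\<in>{C. C \<subseteq> F \<and> r C = 1} \<union> {C. C \<subseteq> F \<and> r C = 2}. g C)
      = (\<Sum>C | C \<subseteq> F \<and> r C = 1. g C) + (\<Sum>C | C \<subseteq> F \<and> r C = 2. g C)"
    by (rule sum.union_disjoint) (use fin in auto)
  also have "(\<Sum>C | C \<subseteq> F \<and> r C = 1. g C) = (\<Sum>P\<in>points F. (\<Sum>C\<in>Pow P. g C) - g {})"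
    unfolding sum_rank_1_in_flat[OF assms]
    by (rule sum.cong[OF refl], rule sum_flat_1) (simp add: points_def)
  finally show ?thesis by simp
qed

section \<open>Counting points and lines\<close>

lemma cl_eq_iff:
  assumes "a \<in> E" "b \<in> E"
  shows "cl {a} = cl {b} \<longleftrightarrow> r {a, b} = 1"
proof
  assume "cl {a} = cl {b}"
  then have "b \<in> cl {a}" using subset_cl[of "{b}"] assms by auto
  then show "r {a, b} = 1" using rank_singleton[OF assms(1)] by (auto simp: cl_def insert_commute)
next
  assume "r {a, b} = 1"
  then have "b \<in> cl {a}" using assms rank_singleton by (auto simp: cl_def insert_commute)
  then show "cl {a} = cl {b}"
    using flat_eq_cl[OF flat_cl, of "{a}" "{b}"] assms rank_singleton by auto
qed

lemma rank_pair_cases: "a \<in> E \<Longrightarrow> b \<in> E \<Longrightarrow> r {a, b} = 1 \<or> r {a, b} = 2"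
  using rank_insert_le[of "{b}" a] rank_insert_ge[of "{b}" a] rank_singleton[of b]
  by (auto simp: le_Suc_eq)

lemma points_eq: "flat k F \<Longrightarrow> points F = (\<lambda>e. cl {e}) ` F"
proof (intro set_eqI iffI)
  fix P assume F: "flat k F" and "P \<in> points F"
  then have P: "flat 1 P" "P \<subseteq> F" by (auto simp: points_def)
  then obtain e where e: "e \<in> P" using flat_1_nonempty by blast
  then have "P = cl {e}" using flat_eq_cl[OF P(1), of "{e}"] rank_singleton flat_subset P by auto
  then show "P \<in> (\<lambda>e. cl {e}) ` F" using e P by auto
next
  fix P assume F: "flat k F" and "P \<in> (\<lambda>e. cl {e}) ` F"
  then obtain e where "e \<in> F" "P = cl {e}" by auto
  then show "P \<in> points F"
    using flat_cl[of "{e}"] rank_singleton[of e] cl_mono_flat[OF F, of "{e}"] flat_subset[OF F]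
    by (auto simp: points_def)
qed

text \<open>The points of \<open>F\<close> are the classes of parallel elements, so picking one
  element from each trades a count of points for a set of pairwise non-parallel elements. Both the
  bound of three points and the recognition of theta classes work with such sets.\<close>

lemma card_points_ge_iff:
  assumes "flat k F"
  shows "j \<le> card (points F) \<longleftrightarrow>
    (\<exists>X. X \<subseteq> F \<and> card X = j \<and> (\<forall>a\<in>X. \<forall>b\<in>X. a \<noteq> b \<longrightarrow> r {a, b} = 2))"
proof
  assume "j \<le> card (points F)"
  then obtain Y where Y: "Y \<subseteq> points F" "card Y = j" by (metis obtain_subset_with_card_n)
  then obtain X where X: "X \<subseteq> F" "Y = (\<lambda>e. cl {e}) ` X" "inj_on (\<lambda>e. cl {e}) X"
    unfolding points_eq[OF assms] subset_image_inj by blast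
  have "card X = j" using X Y card_image by metis
  moreover have "r {a, b} = 2" if "a \<in> X" "b \<in> X" "a \<noteq> b" for a b
  proof -
    have "a \<in> E" "b \<in> E" using that X(1) flat_subset[OF assms] by auto
    moreover have "cl {a} \<noteq> cl {b}" using inj_onD[OF X(3) _ that(1,2)] that(3) by blast
    ultimately show ?thesis using cl_eq_iff[of a b] rank_pair_cases[of a b] by blast
  qed
  ultimately show "\<exists>X. X \<subseteq> F \<and> card X = j \<and> (\<forall>a\<in>X. \<forall>b\<in>X. a \<noteq> b \<longrightarrow> r {a, b} = 2)"
    using X by blast
next
  assume "\<exists>X. X \<subseteq> F \<and> card X = j \<and> (\<forall>a\<in>X. \<forall>b\<in>X. a \<noteq> b \<longrightarrow> r {a, b} = 2)"
  then obtain X where X: "X \<subseteq> F" "card X = j" "\<forall>a\<in>X. \<forall>b\<in>X. a \<noteq> b \<longrightarrow> r {a, b} = 2" by blast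
  have "inj_on (\<lambda>e. cl {e}) X"
  proof (rule inj_onI, rule ccontr)
    fix a b assume ab: "a \<in> X" "b \<in> X" "cl {a} = cl {b}" "a \<noteq> b"
    then have "a \<in> E" "b \<in> E" using X(1) flat_subset[OF assms] by auto
    then have "r {a, b} = 1" using ab(3) cl_eq_iff by blast
    then show False using X(3) ab by simp
  qed
  then have "j = card ((\<lambda>e. cl {e}) ` X)" using X card_image by metis
  also have "\<dots> \<le> card (points F)"
    by (rule card_mono[OF finite_points]) (use X(1) points_eq[OF assms] in auto)
  finally show "j \<le> card (points F)" .
qed

lemma card_points_ge_2:
  assumes "flat 2 F"
  shows "2 \<le> card (points F)"
proof -
  obtain a where a: "a \<in> F" using assms rank_empty by (fastforce simp: flat_def)
  have F: "F \<subseteq> E" using flat_subset[OF assms] .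
  have "\<not> F \<subseteq> cl {a}"
    using rank_mono[of F "cl {a}"] cl_subset rank_cl[of "{a}"] rank_singleton[of a] a F
      flat_rank[OF assms] by auto
  then obtain b where b: "b \<in> F" "b \<notin> cl {a}" by blast
  have E: "a \<in> E" "b \<in> E" using a b F by auto
  then have "r {a, b} = 2"
    using b rank_pair_cases[of a b] rank_singleton[of a] by (auto simp: cl_def insert_commute)
  moreover have "a \<noteq> b" using b E subset_cl[of "{a}"] by auto
  ultimately show ?thesis
    unfolding card_points_ge_iff[OF assms] using a b
    by (intro exI[of _ "{a, b}"]) (auto simp: insert_commute)
qed

text \<open>An element \<open>q\<close> of \<open>Q\<close> outside the flat \<open>P\<close> raises
  the rank of \<open>P\<close> to two; every other element of \<open>Q\<close> is parallel to
  \<open>q\<close> and adds nothing more.\<close>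

lemma rank_Un_points:
  assumes "flat 1 P" "flat 1 Q" "P \<noteq> Q"
  shows "r (P \<union> Q) = 2"
proof -
  have PE: "P \<subseteq> E" "Q \<subseteq> E" using assms flat_subset by auto
  have "\<not> Q \<subseteq> P"
    using flat_unique[OF assms(1,2), of Q] assms(3) flat_rank[OF assms(2)] by auto
  then obtain q where q: "q \<in> Q" "q \<notin> P" by blast
  then have "q \<in> E" using PE by blast
  have "r (insert q P) \<noteq> r P" using assms(1) q PE by (auto simp: flat_def)
  then have 2: "r (insert q P) = 2"
    using rank_insert_le[of P q] rank_insert_ge[of P q] flat_rank[OF assms(1)] \<open>q \<in> E\<close> PE by auto
  have "r (insert e (insert q P)) = r (insert q P)" if "e \<in> Q" for e
  proof (rule rank_insert_eq_mono[of "{q}"])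
    have "e \<in> E" "q \<in> E" using that q PE by auto
    have "r {e, q} \<le> 1" using rank_mono[of "{e, q}" Q] that q PE flat_rank[OF assms(2)] by auto
    then show "r {e, q} = r {q}"
      using rank_pair_cases[of e q] rank_singleton[of q] \<open>e \<in> E\<close> \<open>q \<in> E\<close> by auto
  qed (use PE q that in auto)
  then have "r (insert q P \<union> Q) = 2"
    using rank_Un_eq[of "insert q P" Q] 2 PE \<open>q \<in> E\<close> by simp
  then show ?thesis using q by (simp add: insert_absorb)
qed

text \<open>Two distinct points span exactly one line, the closure of their union, so pairs of
  points can be counted line by line.\<close>

lemma choose_two_points:
  "card {P. flat 1 P} choose 2 = (\<Sum>F | flat 2 F. card (points F) choose 2)"
proof -
  have eq: "{B. B \<subseteq> {P. flat 1 P} \<and> card B = 2}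
      = (\<Union>F\<in>{F. flat 2 F}. {B. B \<subseteq> points F \<and> card B = 2})" (is "?L = ?R")
  proof
    show "?L \<subseteq> ?R"
    proof
      fix B assume "B \<in> ?L"
      then have B: "B \<subseteq> {P. flat 1 P}" "card B = 2" by auto
      obtain P Q where "B = {P, Q}" "P \<noteq> Q" using B(2) card_2_iff[of B] by metis
      with B have PQ: "B = {P, Q}" "P \<noteq> Q" "flat 1 P" "flat 1 Q" "card B = 2" by auto
      then have "P \<union> Q \<subseteq> E" using flat_subset by blast
      have "flat 2 (cl (P \<union> Q))" "P \<union> Q \<subseteq> cl (P \<union> Q)"
        using flat_cl[of "P \<union> Q"] subset_cl[of "P \<union> Q"] rank_Un_points[of P Q] PQ(2-4)
          \<open>P \<union> Q \<subseteq> E\<close> by auto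
      then show "B \<in> ?R" using PQ by (auto simp: points_def)
    qed
  qed (auto simp: points_def)
  have "card {P. flat 1 P} choose 2 = card {B. B \<subseteq> {P. flat 1 P} \<and> card B = 2}"
    by (simp add: n_subsets)
  also have "\<dots> = (\<Sum>F | flat 2 F. card {B. B \<subseteq> points F \<and> card B = 2})"
    unfolding eq
  proof (rule card_UN_disjoint)
    show "\<forall>i\<in>{F. flat 2 F}. finite {B. B \<subseteq> points i \<and> card B = 2}"
      by (auto intro: finite_subset[of _ "Pow (points _)"])
    show "\<forall>i\<in>{F. flat 2 F}. \<forall>j\<in>{F. flat 2 F}. i \<noteq> j \<longrightarrow>
        {B. B \<subseteq> points i \<and> card B = 2} \<inter> {B. B \<subseteq> points j \<and> card B = 2} = {}"
    proof (intro ballI impI equals0I)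
      fix F F' B assume F: "F \<in> {F. flat 2 F}" "F' \<in> {F. flat 2 F}" "F \<noteq> F'"
        and B: "B \<in> {B. B \<subseteq> points F \<and> card B = 2} \<inter> {B. B \<subseteq> points F' \<and> card B = 2}"
      then have "card B = 2" by simp
      then obtain P Q where PQ: "B = {P, Q}" "P \<noteq> Q" using card_2_iff[of B] by metis
      have "P \<union> Q \<subseteq> F" "P \<union> Q \<subseteq> F'" "r (P \<union> Q) = 2"
        using PQ B rank_Un_points by (auto simp: points_def)
      then show False using F flat_unique[of 2 F F' "P \<union> Q"] by simp
    qed
  qed simp
  finally show ?thesis by (simp add: n_subsets)
qed

text \<open>When the Tutte sum is collected by the rank \<open>i\<close> of \<open>C\<close>, this
  is the coefficient of x^a in the factor of (y - 1)^(R - i).\<close>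

definition rank_coeff :: "nat \<Rightarrow> nat \<Rightarrow> int" where
  "rank_coeff i a = (\<Sum>C | C \<subseteq> E \<and> r C = i. coeff ([:-1, 1:] ^ (card C - i)) a)"

lemma rank_le_card: "C \<subseteq> E \<Longrightarrow> r C \<le> card C"
proof -
  have "C \<subseteq> E \<longrightarrow> r C \<le> card C" if "finite C" for C
    using that
  proof (induction C rule: finite_induct)
    case (insert x C)
    then show ?case using rank_insert_le[of C x] by auto
  qed (simp add: rank_empty)
  then show "C \<subseteq> E \<Longrightarrow> r C \<le> card C" using finite_sub by blast
qed

lemma rank_coeff_const:
  "rank_coeff i 0 = (-1) ^ i * (\<Sum>C | C \<subseteq> E \<and> r C = i. (-1) ^ card C)"
  unfolding rank_coeff_def sum_distrib_left
  by (rule sum.cong) (auto simp: coeff_x_minus_1_power_0 minus_one_power_diff rank_le_card)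

lemma rank_coeff_linear:
  "rank_coeff i 1 = - ((-1) ^ i) * ((\<Sum>C | C \<subseteq> E \<and> r C = i. int (card C) * (-1) ^ card C)
      - int i * (\<Sum>C | C \<subseteq> E \<and> r C = i. (-1) ^ card C))"
proof -
  have "rank_coeff i 1 = (\<Sum>C | C \<subseteq> E \<and> r C = i.
      - ((-1) ^ i) * (int (card C) * (-1) ^ card C - int i * (-1) ^ card C))"
    unfolding rank_coeff_def
  proof (rule sum.cong)
    fix C assume "C \<in> {C. C \<subseteq> E \<and> r C = i}"
    then have "i \<le> card C" using rank_le_card by auto
    then show "coeff ([:-1, 1:] ^ (card C - i)) 1
        = - ((-1) ^ i) * (int (card C) * (-1) ^ card C - int i * (-1) ^ card C)"
      unfolding coeff_x_minus_1_power_1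
      by (simp add: minus_one_power_diff of_nat_diff algebra_simps)
  qed simp
  then show ?thesis by (simp only: sum_distrib_left[symmetric] sum_subtractf)
qed

lemma rank_coeff_0: "rank_coeff 0 0 = 1" "rank_coeff 0 1 = 0"
proof -
  have "{C. C \<subseteq> E \<and> r C = 0} = {{}}" using rank_eq_0_iff rank_empty by auto
  then show "rank_coeff 0 0 = 1" "rank_coeff 0 1 = 0" by (simp_all add: rank_coeff_def)
qed

section \<open>Alternating sums over sets of rank one and two\<close>

lemma alternating_sum_rank_1:
  "(\<Sum>C | C \<subseteq> E \<and> r C = 1. (-1) ^ card C) = - int (card {P. flat 1 P})"
proof -
  have "(\<Sum>C | C \<subseteq> P \<and> r C = 1. (-1) ^ card C) = (-1::int)" if "flat 1 P" for P
    using finite_sub[OF flat_subset[OF that]] flat_1_nonempty[OF that]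
    unfolding sum_flat_1[OF that] by (simp add: sum_Pow_alternating)
  then show ?thesis unfolding sum_by_flats[of _ 1] by simp
qed

lemma alternating_card_sum_rank_1:
  "(\<Sum>C | C \<subseteq> E \<and> r C = 1. int (card C) * (-1) ^ card C) = - int (card {P. flat 1 P \<and> card P = 1})"
proof -
  have "(\<Sum>C | C \<subseteq> P \<and> r C = 1. int (card C) * (-1) ^ card C) = (if card P = 1 then -1 else 0)"
    if "flat 1 P" for P
    using finite_sub[OF flat_subset[OF that]]
    unfolding sum_flat_1[OF that] by (simp add: sum_Pow_alternating_card)
  then have "(\<Sum>C | C \<subseteq> E \<and> r C = 1. int (card C) * (-1) ^ card C)
      = (\<Sum>P | flat 1 P. if card P = 1 then -1 else 0)"
    unfolding sum_by_flats[of _ 1] by simp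
  also have "\<dots> = - int (card {P. flat 1 P \<and> card P = 1})"
    by (subst sum.inter_filter[symmetric]) auto
  finally show ?thesis .
qed

lemma card_flat_ge_rank: "flat k F \<Longrightarrow> k \<le> card F"
  using rank_le_card[of F] flat_rank[of k F] flat_subset[of k F] by auto

text \<open>A line with k points contributes 0 - 1 + k: the full power set gives 0, the empty set is
  subtracted, and each point gives back 1 because its nonempty subsets sum to -1.\<close>

lemma alternating_sum_rank_2:
  "(\<Sum>C | C \<subseteq> E \<and> r C = 2. (-1) ^ card C) = (\<Sum>F | flat 2 F. int (card (points F)) - 1)"
  unfolding sum_by_flats[of _ 2]
proof (rule sum.cong[OF refl])
  fix F assume "F \<in> {F. flat 2 F}"
  then have F: "flat 2 F" by simp
  have "(\<Sum>P\<in>points F. (\<Sum>C\<in>Pow P. (-1) ^ card C) - (-1) ^ card ({}::'e set)) = (\<Sum>P\<in>points F. -1 :: int)"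
  proof (rule sum.cong[OF refl])
    fix P assume "P \<in> points F"
    then have "flat 1 P" by (simp add: points_def)
    then show "(\<Sum>C\<in>Pow P. (-1) ^ card C) - (-1) ^ card ({}::'e set) = (-1 :: int)"
      using finite_sub[OF flat_subset] flat_1_nonempty by (simp add: sum_Pow_alternating)
  qed
  then show "(\<Sum>C | C \<subseteq> F \<and> r C = 2. (-1) ^ card C) = int (card (points F)) - 1"
    using finite_sub[OF flat_subset[OF F]] card_flat_ge_rank[OF F]
    unfolding sum_flat_2[OF F] by (auto simp: sum_Pow_alternating)
qed

text \<open>A line has at least two elements, so its full power set contributes zero, as does the
  empty set. A point matters only if it is a singleton, in which case a value of -1 is
  subtracted.\<close>

lemma alternating_card_sum_rank_2:
  "(\<Sum>C | C \<subseteq> E \<and> r C = 2. int (card C) * (-1) ^ card C)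
   = (\<Sum>F | flat 2 F. int (card {P \<in> points F. card P = 1}))"
  unfolding sum_by_flats[of _ 2]
proof (rule sum.cong[OF refl])
  fix F assume "F \<in> {F. flat 2 F}"
  then have F: "flat 2 F" by simp
  have "(\<Sum>P\<in>points F. (\<Sum>C\<in>Pow P. int (card C) * (-1) ^ card C) - int (card ({}::'e set)) * (-1) ^ card ({}::'e set))
      = (\<Sum>P\<in>points F. if card P = 1 then -1 else 0)"
  proof (rule sum.cong[OF refl])
    fix P assume "P \<in> points F"
    then have "flat 1 P" by (simp add: points_def)
    then show "(\<Sum>C\<in>Pow P. int (card C) * (-1) ^ card C) - int (card ({}::'e set)) * (-1) ^ card ({}::'e set)
        = (if card P = 1 then -1 else 0)"
      using finite_sub[OF flat_subset] by (simp add: sum_Pow_alternating_card)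
  qed
  also have "\<dots> = - int (card {P \<in> points F. card P = 1})"
    by (subst sum.inter_filter[symmetric]) auto
  finally show "(\<Sum>C | C \<subseteq> F \<and> r C = 2. int (card C) * (-1) ^ card C)
      = int (card {P \<in> points F. card P = 1})"
    using finite_sub[OF flat_subset[OF F]] card_flat_ge_rank[OF F]
    unfolding sum_flat_2[OF F] by (auto simp: sum_Pow_alternating_card)
qed

lemma rank_coeff_1_0: "rank_coeff 1 0 = int (card {P. flat 1 P})"
  unfolding rank_coeff_const alternating_sum_rank_1 by simp

lemma card_trivial_split:
  assumes "finite S" "\<And>P. P \<in> S \<Longrightarrow> flat 1 P"
  shows "card S = card {P \<in> S. card P = 1} + card {P \<in> S. 2 \<le> card P}"
proof -
  have "card P = 1 \<or> 2 \<le> card P" if "P \<in> S" for P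
    using card_flat_ge_rank[OF assms(2)[OF that]] by auto
  then have "S = {P \<in> S. card P = 1} \<union> {P \<in> S. 2 \<le> card P}" by auto
  then have "card S = card ({P \<in> S. card P = 1} \<union> {P \<in> S. 2 \<le> card P})" by simp
  also have "\<dots> = card {P \<in> S. card P = 1} + card {P \<in> S. 2 \<le> card P}"
    by (rule card_Un_disjoint) (use assms in auto)
  finally show ?thesis .
qed

lemma rank_coeff_1_1: "rank_coeff 1 1 = int (card {P. flat 1 P \<and> 2 \<le> card P})"
  using card_trivial_split[of "{P. flat 1 P}"]
  unfolding rank_coeff_linear alternating_sum_rank_1 alternating_card_sum_rank_1 by simp

text \<open>For k = 2 and k = 3 one has k - 1 = (k choose 2) - [k = 3], and by
  \<open>choose_two_points\<close> the binomials add up to the number of pairs of points.\<close>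

lemma rank_coeff_2_0:
  assumes "\<And>F. flat 2 F \<Longrightarrow> card (points F) \<le> 3"
  shows "rank_coeff 2 0 = int (card {P. flat 1 P} choose 2)
      - int (card {F. flat 2 F \<and> card (points F) = 3})"
proof -
  have "int (card (points F)) - 1 = int (card (points F) choose 2) - (if card (points F) = 3 then 1 else 0)"
    if "flat 2 F" for F
  proof -
    have "card (points F) = 2 \<or> card (points F) = 3"
      using card_points_ge_2[OF that] assms[OF that] by auto
    then show ?thesis by (auto simp: choose_two)
  qed
  then have "rank_coeff 2 0
      = (\<Sum>F | flat 2 F. int (card (points F) choose 2) - (if card (points F) = 3 then 1 else 0))"
    unfolding rank_coeff_const alternating_sum_rank_2 by simp
  also have "\<dots> = int (card {P. flat 1 P} choose 2) - int (card {F. flat 2 F \<and> card (points F) = 3})"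
    unfolding choose_two_points sum_subtractf
    by (simp flip: sum.inter_filter)
  finally show ?thesis .
qed

text \<open>A line with k points, t of them one-element points, contributes 2 (k - 1) - t = (k - t)
  + (k - 2). Here k - t counts its non-trivial points, and k - 2 is 1 exactly for k = 3.\<close>

lemma rank_coeff_2_1:
  assumes "\<And>F. flat 2 F \<Longrightarrow> card (points F) \<le> 3"
  shows "rank_coeff 2 1 = (\<Sum>A | flat 1 A \<and> 2 \<le> card A. int (card {F. flat 2 F \<and> A \<subseteq> F}))
      + int (card {F. flat 2 F \<and> card (points F) = 3})"
proof -
  have "rank_coeff 2 1 = (\<Sum>F | flat 2 F. 2 * (int (card (points F)) - 1)
      - int (card {P \<in> points F. card P = 1}))"
    unfolding rank_coeff_linear alternating_sum_rank_2 alternating_card_sum_rank_2 sum_subtractf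
    by (simp add: sum_subtractf sum_distrib_left)
  also have "\<dots> = (\<Sum>F | flat 2 F. int (card {P \<in> points F. 2 \<le> card P})
      + (if card (points F) = 3 then 1 else 0))"
  proof (rule sum.cong[OF refl])
    fix F assume "F \<in> {F. flat 2 F}"
    then have F: "flat 2 F" by simp
    have "card (points F) = 2 \<or> card (points F) = 3"
      using card_points_ge_2[OF F] assms[OF F] by auto
    moreover have "card (points F)
        = card {P \<in> points F. card P = 1} + card {P \<in> points F. 2 \<le> card P}"
      by (rule card_trivial_split) (auto simp: points_def)
    ultimately show "2 * (int (card (points F)) - 1) - int (card {P \<in> points F. card P = 1})
        = int (card {P \<in> points F. 2 \<le> card P}) + (if card (points F) = 3 then 1 else 0)"
      by auto
  qed
  also have "\<dots> = (\<Sum>F | flat 2 F. int (card {P \<in> points F. 2 \<le> card P}))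
      + int (card {F. flat 2 F \<and> card (points F) = 3})"
    unfolding sum.distrib by (simp flip: sum.inter_filter)
  \<comment> \<open>Double counting of the incidences between lines and non-trivial points: the sum
    over lines becomes a sum over points.\<close>
  also have "(\<Sum>F | flat 2 F. int (card {P \<in> points F. 2 \<le> card P}))
      = (\<Sum>F | flat 2 F. \<Sum>A | A \<in> {A. flat 1 A \<and> 2 \<le> card A} \<and> A \<subseteq> F. 1)"
    by (auto simp: points_def intro!: sum.cong arg_cong[where f = card])
  also have "\<dots> = (\<Sum>A | flat 1 A \<and> 2 \<le> card A. \<Sum>F | F \<in> {F. flat 2 F} \<and> A \<subseteq> F. 1)"
    by (rule sum.swap_restrict) auto
  finally show ?thesis by simp
qed

end

section \<open>Components and the cographic matroid\<close>

lemma equiv_conn: "equiv V (conn V ends A)"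
proof (rule equivI)
  have "sym (edge_rel ends A)"
    by (auto simp: sym_def edge_rel_def insert_commute)
  then have "sym ((edge_rel ends A)\<^sup>*)" by (rule sym_rtrancl)
  then show "sym (conn V ends A)" by (auto simp: sym_def conn_def)
  show "trans (conn V ends A)" by (auto simp: trans_def conn_def)
qed (auto simp: conn_def refl_on_def)

lemma conn_refl: "v \<in> V \<Longrightarrow> (v, v) \<in> conn V ends A"
  by (simp add: conn_def)

lemma conn_sym: "(u, v) \<in> conn V ends A \<Longrightarrow> (v, u) \<in> conn V ends A"
  using equiv_conn[of V ends A] by (auto simp: equiv_def sym_def)

lemma conn_trans:
  "(u, v) \<in> conn V ends A \<Longrightarrow> (v, w) \<in> conn V ends A \<Longrightarrow> (u, w) \<in> conn V ends A"
  by (auto simp: conn_def)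

lemma conn_in: "(u, v) \<in> conn V ends A \<Longrightarrow> u \<in> V \<and> v \<in> V"
  by (auto simp: conn_def)

lemma conn_mono: "A \<subseteq> B \<Longrightarrow> conn V ends A \<subseteq> conn V ends B"
  unfolding conn_def edge_rel_def by (intro Int_mono rtrancl_mono) auto

lemma conn_edge: "e \<in> A \<Longrightarrow> ends e = {u, w} \<Longrightarrow> u \<in> V \<Longrightarrow> w \<in> V \<Longrightarrow> (u, w) \<in> conn V ends A"
  unfolding conn_def edge_rel_def by auto

lemma conn_class_eq_iff:
  "u \<in> V \<Longrightarrow> v \<in> V \<Longrightarrow> conn V ends A `` {u} = conn V ends A `` {v} \<longleftrightarrow> (u, v) \<in> conn V ends A"
  using equiv_conn eq_equiv_class_iff by metis

text \<open>A path can be shortened so that it crosses \<open>e\<close> at most once, in one of the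
  two directions.\<close>

lemma conn_insert:
  assumes "ends e = {u, w}" "u \<in> V" "w \<in> V"
  shows "conn V ends (insert e A) = conn V ends A
    \<union> {(x, y). (x, u) \<in> conn V ends A \<and> (w, y) \<in> conn V ends A}
    \<union> {(x, y). (x, w) \<in> conn V ends A \<and> (u, y) \<in> conn V ends A}"
proof -
  have sym: "(a, b) \<in> (edge_rel ends A)\<^sup>* \<longleftrightarrow> (b, a) \<in> (edge_rel ends A)\<^sup>*" for a b
    using sym_rtrancl[of "edge_rel ends A"]
    by (auto simp: sym_def edge_rel_def insert_commute)
  have "edge_rel ends (insert e A) = insert (u, w) (insert (w, u) (edge_rel ends A))"
    using assms(1) by (auto simp: edge_rel_def doubleton_eq_iff)
  then have "(edge_rel ends (insert e A))\<^sup>* = (edge_rel ends A)\<^sup>*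
    \<union> {(x, y). (x, u) \<in> (edge_rel ends A)\<^sup>* \<and> (w, y) \<in> (edge_rel ends A)\<^sup>*}
    \<union> {(x, y). (x, w) \<in> (edge_rel ends A)\<^sup>* \<and> (u, y) \<in> (edge_rel ends A)\<^sup>*}"
    by (auto simp: rtrancl_insert sym intro: rtrancl_trans)
  then show ?thesis using assms(2,3) by (auto simp: conn_def)
qed

lemma finite_components: "finite V \<Longrightarrow> finite (V // conn V ends A)"
  by (simp add: quotient_def)

text \<open>The classes of \<open>u\<close> and \<open>w\<close> are replaced by their union, which
  was not a class before, and every other class survives unchanged.\<close>

lemma card_quotient_merge:
  assumes R: "equiv V R" and fin: "finite V" and uw: "u \<in> V" "w \<in> V" "(u, w) \<notin> R"
    and R': "R' = R \<union> {(x, y). (x, u) \<in> R \<and> (w, y) \<in> R} \<union> {(x, y). (x, w) \<in> R \<and> (u, y) \<in> R}"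
  shows "card (V // R) = Suc (card (V // R'))"
proof -
  let ?U = "R `` {u}" and ?W = "R `` {w}"
  have sym: "(a, b) \<in> R \<Longrightarrow> (b, a) \<in> R" for a b using R by (auto simp: equiv_def sym_def)
  have trans: "(a, b) \<in> R \<Longrightarrow> (b, c) \<in> R \<Longrightarrow> (a, c) \<in> R" for a b c
    using R by (auto simp: equiv_def trans_def)
  have refl: "a \<in> V \<Longrightarrow> (a, a) \<in> R" for a using R by (auto simp: equiv_def refl_on_def)
  have cls: "R' `` {x} = (if (u, x) \<in> R \<or> (w, x) \<in> R then ?U \<union> ?W else R `` {x})" if "x \<in> V" for x
  proof (cases "(u, x) \<in> R \<or> (w, x) \<in> R")
    case True
    have "(x, y) \<in> R' \<longleftrightarrow> (u, y) \<in> R \<or> (w, y) \<in> R" for y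
      using True sym trans unfolding R' by blast
    then show ?thesis using True by auto
  next
    case False
    have "(x, y) \<in> R' \<longleftrightarrow> (x, y) \<in> R" for y
      using False sym unfolding R' by blast
    then show ?thesis using False by auto
  qed
  have eq: "V // R' = insert (?U \<union> ?W) (V // R - {?U, ?W})"
  proof (intro set_eqI iffI)
    fix K assume "K \<in> V // R'"
    then obtain x where x: "x \<in> V" "K = R' `` {x}" by (auto simp: quotient_def)
    show "K \<in> insert (?U \<union> ?W) (V // R - {?U, ?W})"
    proof (cases "(u, x) \<in> R \<or> (w, x) \<in> R")
      case False
      then have "R `` {x} \<noteq> ?U" "R `` {x} \<noteq> ?W" using refl[OF x(1)] by auto
      then show ?thesis using False x cls[OF x(1)] by (auto simp: quotient_def)
    qed (use x cls[OF x(1)] in auto)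
  next
    fix K assume "K \<in> insert (?U \<union> ?W) (V // R - {?U, ?W})"
    then consider "K = ?U \<union> ?W" | x where "x \<in> V" "K = R `` {x}" "K \<noteq> ?U" "K \<noteq> ?W"
      by (auto simp: quotient_def)
    then show "K \<in> V // R'"
    proof cases
      case 1
      then have "K = R' `` {u}" using cls[OF uw(1)] refl[OF uw(1)] by simp
      then show ?thesis using uw by (auto simp: quotient_def)
    next
      case 2
      then have "(u, x) \<notin> R" "(w, x) \<notin> R" using equiv_class_eq[OF R] by blast+
      then have "K = R' `` {x}" using cls[OF 2(1)] 2 by simp
      then show ?thesis using 2 by (auto simp: quotient_def)
    qed
  qed
  have ne: "?U \<noteq> ?W" using uw R eq_equiv_class by metis
  have UW: "?U \<in> V // R" "?W \<in> V // R" using uw by (auto simp: quotient_def)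
  have fq: "finite (V // R)" using fin by (simp add: quotient_def)
  have notin: "?U \<union> ?W \<notin> V // R"
  proof
    assume "?U \<union> ?W \<in> V // R"
    then obtain x where "?U \<union> ?W = R `` {x}" by (auto simp: quotient_def)
    then have "(x, u) \<in> R" "(x, w) \<in> R" using refl uw by auto
    then show False using sym trans uw by blast
  qed
  have "card (V // R - {?U, ?W}) = card (V // R) - 2"
    using UW ne fq by (subst card_Diff_subset) auto
  moreover have "card {?U, ?W} \<le> card (V // R)" using UW fq by (intro card_mono) auto
  ultimately show ?thesis unfolding eq using notin fq ne by simp
qed

lemma ncomp_insert_connected:
  assumes "ends e = {u, w}" "(u, w) \<in> conn V ends A"
  shows "ncomp V ends (insert e A) = ncomp V ends A"
proof -
  have uw: "u \<in> V" "w \<in> V" using conn_in[OF assms(2)] by auto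
  have "conn V ends (insert e A) = conn V ends A"
    unfolding conn_insert[where ends = ends and e = e and u = u and w = w, OF assms(1) uw]
    using assms(2) by (blast intro: conn_trans conn_sym)
  then show ?thesis by (simp add: ncomp_def)
qed

lemma ncomp_insert_unconnected:
  assumes "finite V" "ends e = {u, w}" "u \<in> V" "w \<in> V" "(u, w) \<notin> conn V ends A"
  shows "ncomp V ends A = Suc (ncomp V ends (insert e A))"
  unfolding ncomp_def
  by (rule card_quotient_merge[OF equiv_conn assms(1,3-5) conn_insert[where ends = ends and e = e and u = u and w = w, OF assms(2-4)]])

lemma multigraph_ends:
  assumes "multigraph V E ends" "e \<in> E"
  obtains u w where "ends e = {u, w}" "u \<in> V" "w \<in> V"
proof -
  have "card (ends e) = 1 \<or> card (ends e) = 2" "ends e \<subseteq> V"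
    using assms by (auto simp: multigraph_def)
  then show ?thesis using that by (auto simp: card_1_singleton_iff card_2_iff)
qed

lemma multigraph_finite: "multigraph V E ends \<Longrightarrow> finite V" "multigraph V E ends \<Longrightarrow> finite E"
  by (auto simp: multigraph_def)

lemma multigraph_subset: "multigraph V E ends \<Longrightarrow> A \<subseteq> E \<Longrightarrow> multigraph V A ends"
  by (auto simp: multigraph_def intro: finite_subset)

lemma ncomp_insert_cases:
  assumes "multigraph V E ends" "e \<in> E"
  shows "ncomp V ends A = ncomp V ends (insert e A) \<or> ncomp V ends A = Suc (ncomp V ends (insert e A))"
proof -
  obtain u w where "ends e = {u, w}" "u \<in> V" "w \<in> V" using multigraph_ends[OF assms] .
  then show ?thesis
    using ncomp_insert_connected ncomp_insert_unconnected multigraph_finite(1)[OF assms(1)] by metis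
qed

text \<open>The ends of \<open>e\<close> are already joined inside \<open>A\<close>, hence inside
  \<open>B\<close>. Read in the complement, this becomes the closure axiom of the dual
  matroid.\<close>

lemma ncomp_insert_eq_mono:
  assumes "multigraph V E ends" "e \<in> E" "A \<subseteq> B" "ncomp V ends (insert e A) = ncomp V ends A"
  shows "ncomp V ends (insert e B) = ncomp V ends B"
proof -
  obtain u w where uw: "ends e = {u, w}" "u \<in> V" "w \<in> V" using multigraph_ends[OF assms(1,2)] .
  have "(u, w) \<in> conn V ends A"
    using ncomp_insert_unconnected[where ends = ends and e = e and u = u and w = w and A = A,
        OF multigraph_finite(1)[OF assms(1)] uw] assms(4) by auto
  then show ?thesis
    using conn_mono[OF assms(3)]
      ncomp_insert_connected[where ends = ends and e = e and u = u and w = w, OF uw(1)] by blast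
qed

section \<open>The cographic rank function\<close>

definition dual_rank :: "'v set \<Rightarrow> 'e set \<Rightarrow> ('e \<Rightarrow> 'v set) \<Rightarrow> 'e set \<Rightarrow> nat" where
  "dual_rank V E ends C = card C + ncomp V ends E - ncomp V ends (E - C)"

text \<open>Deleting one edge creates at most one new component. Hence the natural-number
  subtraction in \<open>dual_rank\<close> never truncates.\<close>

lemma ncomp_Diff_le:
  assumes "multigraph V E ends" "C \<subseteq> E"
  shows "ncomp V ends (E - C) \<le> card C + ncomp V ends E"
proof -
  have "finite C" using finite_subset[OF assms(2) multigraph_finite(2)[OF assms(1)]] .
  then show ?thesis using assms(2)
  proof (induction C rule: finite_induct)
    case (insert e C)
    then have "insert e (E - insert e C) = E - C" by auto
    then have "ncomp V ends (E - insert e C) \<le> Suc (ncomp V ends (E - C))"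
      using ncomp_insert_cases[OF assms(1), of e "E - insert e C"] insert.prems by auto
    then show ?case using insert by auto
  qed simp
qed

lemma dual_rank_eq:
  assumes "multigraph V E ends" "C \<subseteq> E"
  shows "dual_rank V E ends C + ncomp V ends (E - C) = card C + ncomp V ends E"
  using ncomp_Diff_le[OF assms] by (simp add: dual_rank_def)

text \<open>Deleting \<open>e\<close> from \<open>G - C\<close> adds one to the cardinality, and a
  new component cancels this exactly when \<open>e\<close> is a bridge of
  \<open>G - C\<close>.\<close>

lemma dual_rank_insert:
  assumes "multigraph V E ends" "C \<subseteq> E" "e \<in> E - C"
  shows "dual_rank V E ends (insert e C) =
    (if ncomp V ends (E - C - {e}) = ncomp V ends (E - C) then Suc (dual_rank V E ends C)
     else dual_rank V E ends C)"
proof -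
  have eq: "insert e (E - C - {e}) = E - C" "E - insert e C = E - C - {e}" using assms(3) by auto
  have "finite C" using finite_subset[OF assms(2) multigraph_finite(2)[OF assms(1)]] .
  then have "card (insert e C) = Suc (card C)" using assms by simp
  then show ?thesis
    using dual_rank_eq[OF assms(1,2)] dual_rank_eq[OF assms(1), of "insert e C"]
      ncomp_insert_cases[OF assms(1), of e "E - C - {e}"] assms(2,3) unfolding eq by auto
qed

text \<open>Singletons have rank one because \<open>G\<close> has no bridge. The closure axiom says
  that a bridge of \<open>G - C\<close> outside \<open>D\<close> is still a bridge of the smaller
  graph \<open>G - D\<close>; this is the contrapositive of \<open>ncomp_insert_eq_mono\<close>,
  since complements reverse the inclusion.\<close>

lemma dual_matroid:
  assumes G: "multigraph V E ends" and "bridgeless V E ends"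
  shows "loopless_matroid E (dual_rank V E ends)"
proof
  show "finite E" using multigraph_finite(2)[OF G] .
  show 0: "dual_rank V E ends {} = 0" by (simp add: dual_rank_def)
  show "dual_rank V E ends {e} = 1" if "e \<in> E" for e
    using dual_rank_insert[OF G, of "{}" e] that assms(2) 0 by (simp add: bridgeless_def)
  show "dual_rank V E ends C \<le> dual_rank V E ends (insert e C)" if "C \<subseteq> E" "e \<in> E" for C e
    using dual_rank_insert[OF G that(1), of e] that by (cases "e \<in> C") (auto simp: insert_absorb)
  show "dual_rank V E ends (insert e C) \<le> Suc (dual_rank V E ends C)" if "C \<subseteq> E" "e \<in> E" for C e
    using dual_rank_insert[OF G that(1), of e] that by (cases "e \<in> C") (auto simp: insert_absorb)
  show "dual_rank V E ends (insert e D) = dual_rank V E ends D"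
    if CD: "C \<subseteq> D" "D \<subseteq> E" "e \<in> E" "dual_rank V E ends (insert e C) = dual_rank V E ends C" for C D e
  proof (cases "e \<in> D")
    case False
    then have e: "e \<in> E - C" "e \<in> E - D" using CD by auto
    have "C \<subseteq> E" using CD by auto
    have neq: "ncomp V ends (E - C - {e}) \<noteq> ncomp V ends (E - C)"
      using dual_rank_insert[OF G \<open>C \<subseteq> E\<close> e(1)] CD(4) by (auto split: if_splits)
    have "ncomp V ends (E - D - {e}) \<noteq> ncomp V ends (E - D)"
    proof
      assume "ncomp V ends (E - D - {e}) = ncomp V ends (E - D)"
      moreover have "insert e (E - D - {e}) = E - D" "insert e (E - C - {e}) = E - C" using e by auto
      ultimately show False
        using ncomp_insert_eq_mono[OF G CD(3), of "E - D - {e}" "E - C - {e}"] neq CD(1) by auto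
    qed
    then show ?thesis using dual_rank_insert[OF G CD(2) e(2)] by simp
  qed (simp add: insert_absorb)
qed

section \<open>Comparing the component counts of two graphs\<close>

lemma card_image_eq_card_image:
  assumes "\<And>x y. x \<in> S \<Longrightarrow> y \<in> S \<Longrightarrow> f x = f y \<longleftrightarrow> g x = g y"
  shows "card (f ` S) = card (g ` S)"
proof (rule bij_betw_same_card)
  have inv: "inv_into S f (f x) \<in> S" "f (inv_into S f (f x)) = f x" if "x \<in> S" for x
    using that by (auto intro: inv_into_into f_inv_into_f)
  have g: "g (inv_into S f (f x)) = g x" if "x \<in> S" for x
    using assms[OF inv(1)[OF that] that] inv(2)[OF that] by simp
  show "bij_betw (\<lambda>k. g (inv_into S f k)) (f ` S) (g ` S)"
    unfolding bij_betw_def inj_on_def using g assms by (auto simp: image_image)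
qed

lemma ncomp_eq_of_surj:
  assumes "p ` V = V2"
    and "\<And>x y. x \<in> V \<Longrightarrow> y \<in> V \<Longrightarrow> (x, y) \<in> conn V ends A \<longleftrightarrow> (p x, p y) \<in> conn V2 ends2 A2"
  shows "ncomp V2 ends2 A2 = ncomp V ends A"
proof -
  have 1: "V // conn V ends A = (\<lambda>x. conn V ends A `` {x}) ` V"
    by (auto simp: quotient_def)
  have 2: "V2 // conn V2 ends2 A2 = (\<lambda>x. conn V2 ends2 A2 `` {p x}) ` V"
    using assms(1) by (auto simp: quotient_def)
  have "p x \<in> V2" if "x \<in> V" for x using that assms(1) by auto
  then show ?thesis unfolding ncomp_def 1 2
    by (intro card_image_eq_card_image) (simp add: conn_class_eq_iff assms(2))
qed

lemma conn_map:
  assumes "multigraph V A ends" "(x, y) \<in> conn V ends A" "f ` V \<subseteq> V2"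
    and "\<And>e u v. e \<in> A \<Longrightarrow> ends e = {u, v} \<Longrightarrow> u \<in> V \<Longrightarrow> v \<in> V \<Longrightarrow> (f u, f v) \<in> conn V2 ends2 A2"
  shows "(f x, f y) \<in> conn V2 ends2 A2"
proof -
  have xV: "x \<in> V" and "(x, y) \<in> (edge_rel ends A)\<^sup>*" using assms(2) by (auto simp: conn_def)
  from this(2) show ?thesis
  proof (induction rule: rtrancl_induct)
    case base
    then show ?case using xV assms(3) by (auto intro: conn_refl)
  next
    case (step y z)
    then obtain e where e: "e \<in> A" "ends e = {y, z}" by (auto simp: edge_rel_def)
    then have "y \<in> V" "z \<in> V" using assms(1) by (auto simp: multigraph_def)
    then have "(f y, f z) \<in> conn V2 ends2 A2" using assms(4) e by blast
    then show ?case using step.IH conn_trans by metis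
  qed
qed

text \<open>Serves both the contraction in \<open>ncomp_contract\<close> and the suppression in
  \<open>ncomp_suppress\<close>. The maps respect edges only up to connectivity, so an edge may
  collapse to a vertex, and going to the other graph and back may move a vertex within its
  component.\<close>

lemma ncomp_eq_of_retraction:
  assumes "multigraph V A ends" "multigraph V2 A2 ends2"
    and p: "p ` V \<subseteq> V2" and q: "q ` V2 \<subseteq> V" and pq: "\<And>s. s \<in> V2 \<Longrightarrow> p (q s) = s"
    and qp: "\<And>x. x \<in> V \<Longrightarrow> (x, q (p x)) \<in> conn V ends A"
    and pe: "\<And>e u v. e \<in> A \<Longrightarrow> ends e = {u, v} \<Longrightarrow> u \<in> V \<Longrightarrow> v \<in> V \<Longrightarrow> (p u, p v) \<in> conn V2 ends2 A2"
    and qe: "\<And>e u v. e \<in> A2 \<Longrightarrow> ends2 e = {u, v} \<Longrightarrow> u \<in> V2 \<Longrightarrow> v \<in> V2 \<Longrightarrow> (q u, q v) \<in> conn V ends A"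
  shows "ncomp V2 ends2 A2 = ncomp V ends A"
proof (rule ncomp_eq_of_surj)
  show "p ` V = V2"
  proof
    show "V2 \<subseteq> p ` V"
    proof
      fix s assume "s \<in> V2"
      then show "s \<in> p ` V" using pq[of s] q by (intro image_eqI[of _ _ "q s"]) auto
    qed
  qed (rule p)
  fix x y assume xy: "x \<in> V" "y \<in> V"
  show "(x, y) \<in> conn V ends A \<longleftrightarrow> (p x, p y) \<in> conn V2 ends2 A2"
  proof
    assume "(x, y) \<in> conn V ends A"
    then show "(p x, p y) \<in> conn V2 ends2 A2" by (rule conn_map[OF assms(1) _ p]) (blast intro: pe)
  next
    assume "(p x, p y) \<in> conn V2 ends2 A2"
    then have "(q (p x), q (p y)) \<in> conn V ends A" by (rule conn_map[OF assms(2) _ q]) (blast intro: qe)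
    then show "(x, y) \<in> conn V ends A" using qp[OF xy(1)] conn_sym[OF qp[OF xy(2)]] conn_trans
      by metis
  qed
qed

lemma multigraph_contract:
  assumes "multigraph V E ends" "C \<subseteq> E"
  shows "multigraph (contract_V V E ends C) C (contract_ends V E ends C)"
  unfolding multigraph_def
proof (intro conjI ballI)
  show "finite (contract_V V E ends C)"
    using multigraph_finite[OF assms(1)] finite_components by (simp add: contract_V_def)
  show "finite C" using finite_subset[OF assms(2) multigraph_finite(2)[OF assms(1)]] .
  fix e assume "e \<in> C"
  then obtain u w where "ends e = {u, w}" "u \<in> V" "w \<in> V"
    using multigraph_ends[OF assms(1)] assms(2) by blast
  then show "contract_ends V E ends C e \<subseteq> contract_V V E ends C"
    "1 \<le> card (contract_ends V E ends C e)" "card (contract_ends V E ends C e) \<le> 2"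
    by (auto simp: contract_ends_def contract_V_def quotient_def card_insert_if)
qed

text \<open>A vertex goes to its component in \<open>G - C\<close>, and a component goes back to a
  chosen vertex of it. Edges of \<open>A\<close> correspond directly, while edges of
  \<open>E - C\<close> disappear inside a single component.\<close>

lemma ncomp_contract:
  assumes G: "multigraph V E ends" and C: "C \<subseteq> E" and A: "A \<subseteq> C"
  shows "ncomp (contract_V V E ends C) (contract_ends V E ends C) A = ncomp V ends (A \<union> (E - C))"
proof (rule ncomp_eq_of_retraction)
  let ?R = "conn V ends (E - C)" and ?H = "contract_V V E ends C" and ?f = "contract_ends V E ends C"
  let ?p = "\<lambda>v. ?R `` {v}" and ?q = "\<lambda>K. SOME v. v \<in> V \<and> K = ?R `` {v}"
  have q: "?q K \<in> V \<and> K = ?R `` {?q K}" if "K \<in> ?H" for K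
    using that by (intro someI_ex[of "\<lambda>v. v \<in> V \<and> K = ?R `` {v}"]) (auto simp: contract_V_def quotient_def)
  have sub: "?R \<subseteq> conn V ends (A \<union> (E - C))" by (rule conn_mono) auto
  have p: "?p v \<in> ?H" if "v \<in> V" for v using that by (auto simp: contract_V_def quotient_def)
  have pq: "(v, ?q (?p v)) \<in> ?R" if "v \<in> V" for v
    using q[OF p[OF that]] that conn_class_eq_iff[of v V "?q (?p v)"] by blast
  show "multigraph V (A \<union> (E - C)) ends" using multigraph_subset[OF G] A C by auto
  show "multigraph ?H A ?f" using multigraph_subset[OF multigraph_contract[OF G C] A] .
  show "?p ` V \<subseteq> ?H" using p by auto
  show "?q ` ?H \<subseteq> V" using q by auto
  show "?p (?q s) = s" if "s \<in> ?H" for s using q[OF that] by simp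
  show "(x, ?q (?p x)) \<in> conn V ends (A \<union> (E - C))" if "x \<in> V" for x using pq[OF that] sub by blast
  show "(?p u, ?p v) \<in> conn ?H ?f A" if e: "e \<in> A \<union> (E - C)" "ends e = {u, v}" "u \<in> V" "v \<in> V" for e u v
  proof (cases "e \<in> A")
    case True
    then show ?thesis using e p by (intro conn_edge[of e]) (auto simp: contract_ends_def)
  next
    case False
    then have "(u, v) \<in> ?R" using e by (intro conn_edge[of e]) auto
    then have "?p u = ?p v" using e conn_class_eq_iff by metis
    then show ?thesis using p[OF e(3)] by (simp add: conn_refl)
  qed
  show "(?q s, ?q t) \<in> conn V ends (A \<union> (E - C))" if e: "e \<in> A" "?f e = {s, t}" for e s t
  proof -
    obtain u w where uw: "ends e = {u, w}" "u \<in> V" "w \<in> V"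
      using multigraph_ends[OF G] A C e by blast
    have "{s, t} = {?p u, ?p w}" using e(2) uw by (simp add: contract_ends_def)
    then have "s = ?p u \<and> t = ?p w \<or> s = ?p w \<and> t = ?p u" by (simp add: doubleton_eq_iff)
    moreover have "(u, w) \<in> conn V ends (A \<union> (E - C))" using e uw by (intro conn_edge[of e]) auto
    moreover have "(u, ?q (?p u)) \<in> conn V ends (A \<union> (E - C))" "(w, ?q (?p w)) \<in> conn V ends (A \<union> (E - C))"
      using pq uw sub by blast+
    ultimately show ?thesis by (elim disjE conjE) (blast intro: conn_sym conn_trans)+
  qed
qed

section \<open>Series classes as points of the cographic matroid\<close>

locale bridgeless_graph =
  fixes V :: "'v set" and E :: "'e set" and ends :: "'e \<Rightarrow> 'v set"
  assumes graph: "multigraph V E ends" and bridgeless: "bridgeless V E ends"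
begin

sublocale dual: loopless_matroid E "dual_rank V E ends"
  by (rule dual_matroid[OF graph bridgeless])

text \<open>By \<open>dual_rank_insert\<close>, an edge outside \<open>F\<close> fails to raise the
  rank exactly when it is a bridge of \<open>G - F\<close>.\<close>

lemma dual_flat_iff:
  "dual.flat k F \<longleftrightarrow> F \<subseteq> E \<and> dual_rank V E ends F = k \<and> bridgeless V (E - F) ends"
  unfolding dual.flat_def bridgeless_def
  using dual_rank_insert[OF graph, of F] by (auto split: if_splits)

lemma series_set_iff: "series_set V E ends C \<longleftrightarrow> C \<subseteq> E \<and> dual_rank V E ends C \<le> 1"
proof -
  \<comment> \<open>By \<open>dual_rank_eq\<close>, the number of additional components is 2 minus
    the rank of the pair.\<close>
  have pair: "ncomp V ends (E - {e, f}) > ncomp V ends E \<longleftrightarrow> dual_rank V E ends {e, f} \<le> 1"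
    if "e \<in> E" "f \<in> E" "e \<noteq> f" for e f
    using dual_rank_eq[OF graph, of "{e, f}"] that by auto
  show ?thesis
  proof
    assume C: "series_set V E ends C"
    then have CE: "C \<subseteq> E" by (simp add: series_set_def)
    show "C \<subseteq> E \<and> dual_rank V E ends C \<le> 1"
    proof (cases "C = {}")
      case False
      then obtain e where e: "e \<in> C" "e \<in> E" using CE by auto
      have "dual_rank V E ends (insert f {e}) = dual_rank V E ends {e}" if f: "f \<in> C" for f
      proof (cases "e = f")
        case False
        have "f \<in> E" using f CE by auto
        have "dual_rank V E ends {f, e} \<le> 1"
          using C pair[OF \<open>f \<in> E\<close> e(2)] False f e by (auto simp: series_set_def)
        then show ?thesis
          using dual.rank_pair_cases[OF \<open>f \<in> E\<close> e(2)] dual.rank_singleton[OF e(2)] by simp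
      qed simp
      then have "dual_rank V E ends ({e} \<union> C) = dual_rank V E ends {e}"
        using dual.rank_Un_eq[of "{e}" C] CE e by blast
      then show ?thesis using dual.rank_singleton[OF e(2)] CE e by (simp add: insert_absorb)
    qed (simp add: dual.rank_empty)
  next
    assume C: "C \<subseteq> E \<and> dual_rank V E ends C \<le> 1"
    show "series_set V E ends C"
      unfolding series_set_def
    proof (intro conjI ballI impI)
      fix e f assume ef: "e \<in> C" "f \<in> C" "e \<noteq> f"
      have "e \<in> E" "f \<in> E" using ef C by auto
      moreover have "dual_rank V E ends {e, f} \<le> 1"
        using dual.rank_mono[of "{e, f}" C] C ef by auto
      ultimately show "ncomp V ends E < ncomp V ends (E - {e, f})" using pair ef(3) by blast
    qed (use C in simp)
  qed
qed

lemma series_class_iff: "series_class V E ends C \<longleftrightarrow> dual.flat 1 C"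
proof
  assume C: "series_class V E ends C"
  then have CE: "C \<subseteq> E" "dual_rank V E ends C \<le> 1" "C \<noteq> {}"
    by (auto simp: series_class_def series_set_iff)
  then have 1: "dual_rank V E ends C = 1" using dual.rank_eq_0_iff[OF CE(1)] by linarith
  have "dual_rank V E ends (insert e C) \<noteq> 1" if e: "e \<in> E - C" for e
  proof
    assume "dual_rank V E ends (insert e C) = 1"
    then have "series_set V E ends (insert e C)" using e CE by (simp add: series_set_iff)
    then have "insert e C = C" using C unfolding series_class_def by blast
    then show False using e by blast
  qed
  then show "dual.flat 1 C" using CE 1 by (simp add: dual.flat_def)
next
  assume C: "dual.flat 1 C"
  have "D = C" if D: "series_set V E ends D" "C \<subseteq> D" for D
  proof (rule ccontr)
    assume "D \<noteq> C"
    then obtain e where e: "e \<in> D" "e \<notin> C" using D by blast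
    have DE: "D \<subseteq> E" "dual_rank V E ends D \<le> 1" using D(1) by (auto simp: series_set_iff)
    then have "dual_rank V E ends (insert e C) \<le> 1"
      using dual.rank_mono[of "insert e C" D] e D by auto
    moreover have "dual_rank V E ends (insert e C) \<noteq> 1" "e \<in> E"
      using C e DE by (auto simp: dual.flat_def)
    ultimately show False
      using dual.rank_insert_ge[of C e] dual.flat_rank[OF C] dual.flat_subset[OF C] by linarith
  qed
  then show "series_class V E ends C"
    using C dual.flat_1_nonempty[OF C] dual.flat_rank[OF C] dual.flat_subset[OF C]
    by (auto simp: series_class_def series_set_iff)
qed

text \<open>Deletion in the graph is contraction in the cographic matroid: the rank of
  \<open>C\<close> in \<open>G - A\<close> is what \<open>C\<close> adds to the rank of
  \<open>A\<close>.\<close>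

lemma dual_rank_Diff:
  assumes "A \<subseteq> E" "C \<subseteq> E - A"
  shows "dual_rank V E ends (A \<union> C) = dual_rank V E ends A + dual_rank V (E - A) ends C"
proof -
  have "finite A" "finite C" using assms dual.finite_sub by (auto intro: dual.finite_sub)
  then have "card (A \<union> C) = card A + card C" using assms by (intro card_Un_disjoint) auto
  moreover have "E - A - C = E - (A \<union> C)" "A \<union> C \<subseteq> E" using assms by auto
  ultimately show ?thesis
    using dual_rank_eq[OF graph assms(1)] dual_rank_eq[OF graph, of "A \<union> C"]
      dual_rank_eq[OF multigraph_subset[OF graph] assms(2)] by simp
qed

text \<open>The points of the contraction by \<open>A\<close> correspond to the lines through
  \<open>A\<close>, by adding \<open>A\<close> to them.\<close>

lemma num_series_Diff:
  assumes "dual.flat 1 A"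
  shows "num_series V (E - A) ends = card {F. dual.flat 2 F \<and> A \<subseteq> F}"
proof -
  have A: "A \<subseteq> E" "dual_rank V E ends A = 1" "bridgeless V (E - A) ends"
    using assms by (auto simp: dual_flat_iff)
  \<comment> \<open>\<open>G - A\<close> may be disconnected, which is why the locale asks for
    bridgelessness only.\<close>
  interpret H: bridgeless_graph V "E - A" ends
    using multigraph_subset[OF graph] A by unfold_locales auto
  have "{F. dual.flat 2 F \<and> A \<subseteq> F} = (\<union>) A ` {C. series_class V (E - A) ends C}"
  proof (intro set_eqI iffI)
    fix F assume "F \<in> {F. dual.flat 2 F \<and> A \<subseteq> F}"
    then have F: "dual.flat 2 F" "A \<subseteq> F" by auto
    have eq: "A \<union> (F - A) = F" "E - A - (F - A) = E - F" using F(2) by auto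
    have sub: "F - A \<subseteq> E - A" using dual.flat_subset[OF F(1)] by auto
    have "H.dual.flat 1 (F - A)"
      using F sub dual_rank_Diff[OF A(1), of "F - A"] A unfolding H.dual_flat_iff dual_flat_iff eq by auto
    then show "F \<in> (\<union>) A ` {C. series_class V (E - A) ends C}"
      unfolding H.series_class_iff using eq(1) by (intro image_eqI[of _ _ "F - A"]) auto
  next
    fix F assume "F \<in> (\<union>) A ` {C. series_class V (E - A) ends C}"
    then obtain C where C: "F = A \<union> C" "H.dual.flat 1 C" unfolding H.series_class_iff by auto
    then have "C \<subseteq> E - A" "dual_rank V (E - A) ends C = 1" "bridgeless V (E - A - C) ends"
      by (auto simp: H.dual_flat_iff)
    moreover have "E - A - C = E - F" using C by auto
    ultimately show "F \<in> {F. dual.flat 2 F \<and> A \<subseteq> F}"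
      using dual_rank_Diff[OF A(1), of C] A C(1) by (auto simp: dual_flat_iff)
  qed
  moreover have "inj_on ((\<union>) A) {C. series_class V (E - A) ends C}"
    unfolding H.series_class_iff H.dual_flat_iff by (auto simp: inj_on_def)
  ultimately show ?thesis by (simp add: num_series_def card_image)
qed

text \<open>A cographic matroid is binary, so none of its lines has four points: four pairwise
  non-series edges spanning a line would be pairwise non-parallel edges on the three components
  that remain when they are deleted.\<close>

lemma card_points_le_3:
  assumes conn: "ncomp V ends E = 1" and F: "dual.flat 2 F"
  shows "card (dual.points F) \<le> 3"
proof (rule ccontr)
  assume "\<not> card (dual.points F) \<le> 3"
  then have "4 \<le> card (dual.points F)" by simp
  then obtain X where X: "X \<subseteq> F" "card X = 4"
    and pair: "\<And>a b. a \<in> X \<Longrightarrow> b \<in> X \<Longrightarrow> a \<noteq> b \<Longrightarrow> dual_rank V E ends {a, b} = 2"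
    unfolding dual.card_points_ge_iff[OF F] by blast
  have FE: "F \<subseteq> E" "dual_rank V E ends F = 2" using F by (auto simp: dual_flat_iff)
  have XE: "X \<subseteq> E" using X FE by auto
  have finX: "finite X" using X(2) by (intro card_ge_0_finite) simp
  have two: "\<exists>a b. a \<noteq> b \<and> X - {k, l} = {a, b}" if "k \<in> X" "l \<in> X" "k \<noteq> l" for k l
  proof -
    have "card (X - {k, l}) = 2" using that finX X(2) by (subst card_Diff_subset) auto
    then show ?thesis by (auto simp: card_2_iff)
  qed
  let ?B = "E - X"
  \<comment> \<open>Putting \<open>k\<close> and \<open>l\<close> back leaves only the other two
    edges of \<open>X\<close> deleted, and these are not in series.\<close>
  have conn1: "ncomp V ends (insert k (insert l ?B)) = 1" if kl: "k \<in> X" "l \<in> X" "k \<noteq> l" for k l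
  proof -
    obtain a b where ab: "a \<noteq> b" "X - {k, l} = {a, b}" using two[OF kl] by blast
    then have abX: "a \<in> X" "b \<in> X" by auto
    have "insert k (insert l ?B) = E - (X - {k, l})" using kl XE by auto
    then have "insert k (insert l ?B) = E - {a, b}" using ab by simp
    then show ?thesis
      using dual_rank_eq[OF graph, of "{a, b}"] pair[OF abX ab(1)] ab(1) abX XE conn by auto
  qed
  obtain a b where ab: "a \<in> X" "b \<in> X" "a \<noteq> b"
  proof -
    have "X \<noteq> {}" using X by auto
    then obtain a where a: "a \<in> X" by blast
    have "card (X - {a}) = 3" using X a by simp
    then have "X - {a} \<noteq> {}" by (metis card.empty zero_neq_numeral)
    then show ?thesis using that a by blast
  qed
  have "2 \<le> dual_rank V E ends X" using dual.rank_mono[of "{a, b}" X] pair[OF ab] ab XE by auto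
  moreover have "dual_rank V E ends X \<le> 2" using dual.rank_mono[OF X(1) FE(1)] FE by simp
  \<comment> \<open>\<open>X\<close> has four elements and rank two, so 4 + 1 - 2 components
    remain.\<close>
  ultimately have nB: "ncomp V ends ?B = 3"
    using dual_rank_eq[OF graph XE] conn X(2) by linarith
  \<comment> \<open>Adding \<open>l\<close> and then another \<open>k\<close> leads from three
    components to one, so each of the two edges must merge two components.\<close>
  have step: "ncomp V ends (insert l ?B) = 2" if "l \<in> X" for l
  proof -
    obtain k where k: "k \<in> X" "k \<noteq> l" using ab by metis
    have "k \<in> E" "l \<in> E" using k that XE by auto
    then show ?thesis
      using ncomp_insert_cases[OF graph, of l ?B] ncomp_insert_cases[OF graph, of k "insert l ?B"]
        conn1[OF k(1) that k(2)] nB by auto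
  qed
  let ?q = "\<lambda>e. (\<lambda>v. conn V ends ?B `` {v}) ` ends e"
  have "inj_on ?q X"
  proof (rule inj_onI, rule ccontr)
    fix k l assume kl: "k \<in> X" "l \<in> X" "?q k = ?q l" "k \<noteq> l"
    obtain u w where uw: "ends k = {u, w}" "u \<in> V" "w \<in> V"
      using multigraph_ends[OF graph, of k] kl XE by blast
    obtain x y where xy: "ends l = {x, y}" "x \<in> V" "y \<in> V"
      using multigraph_ends[OF graph, of l] kl XE by blast
    have "(u, x) \<in> conn V ends ?B \<and> (w, y) \<in> conn V ends ?B
        \<or> (u, y) \<in> conn V ends ?B \<and> (w, x) \<in> conn V ends ?B"
      using kl(3) uw xy by (auto simp: doubleton_eq_iff conn_class_eq_iff)
    moreover have "conn V ends ?B \<subseteq> conn V ends (insert l ?B)" by (rule conn_mono) auto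
    moreover have "(x, y) \<in> conn V ends (insert l ?B)" using xy by (intro conn_edge[of l]) auto
    ultimately have "(u, w) \<in> conn V ends (insert l ?B)"
      by (meson conn_sym conn_trans subsetD)
    then have "ncomp V ends (insert k (insert l ?B)) = ncomp V ends (insert l ?B)"
      using ncomp_insert_connected[of ends k u w] uw by blast
    then show False using conn1[OF kl(1,2,4)] step[OF kl(2)] by simp
  qed
  moreover have "?q ` X \<subseteq> {S. S \<subseteq> V // conn V ends ?B \<and> card S = 2}"
  proof
    fix S assume "S \<in> ?q ` X"
    then obtain k where k: "k \<in> X" "S = ?q k" by blast
    obtain u w where uw: "ends k = {u, w}" "u \<in> V" "w \<in> V"
      using multigraph_ends[OF graph, of k] k XE by blast
    have "(u, w) \<notin> conn V ends ?B"
      using ncomp_insert_connected[of ends k u w V ?B] uw step[OF k(1)] nB by auto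
    then have "conn V ends ?B `` {u} \<noteq> conn V ends ?B `` {w}" using uw conn_class_eq_iff by metis
    then show "S \<in> {S. S \<subseteq> V // conn V ends ?B \<and> card S = 2}"
      using k uw by (auto simp: quotient_def)
  qed
  \<comment> \<open>Four edges would need distinct pairs of components, but three components form
    only three pairs.\<close>
  ultimately have "card X \<le> card {S. S \<subseteq> V // conn V ends ?B \<and> card S = 2}"
    by (rule card_inj_on_le)
      (simp add: finite_components[OF multigraph_finite(1)[OF graph]])
  also have "\<dots> = ncomp V ends ?B choose 2"
    using finite_components[OF multigraph_finite(1)[OF graph], of ends ?B]
    by (simp add: n_subsets ncomp_def)
  finally show False using nB X(2) by (simp add: choose_two)
qed

end

section \<open>Theta graphs\<close>

lemma ncomp_eq_1_iff:
  assumes "z \<in> V"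
  shows "ncomp V ends A = 1 \<longleftrightarrow> (\<forall>x\<in>V. (x, z) \<in> conn V ends A)"
proof
  assume "ncomp V ends A = 1"
  then obtain K where "V // conn V ends A = {K}"
    by (auto simp: ncomp_def card_1_singleton_iff)
  then have "conn V ends A `` {x} = K" if "x \<in> V" for x
    using quotientI[OF that, of "conn V ends A"] by auto
  then show "\<forall>x\<in>V. (x, z) \<in> conn V ends A" using assms conn_class_eq_iff by metis
next
  assume all: "\<forall>x\<in>V. (x, z) \<in> conn V ends A"
  have "conn V ends A `` {x} = conn V ends A `` {z}" if "x \<in> V" for x
    unfolding conn_class_eq_iff[OF that assms, of ends A] using all that by blast
  then have "(\<lambda>x. conn V ends A `` {x}) ` V = {conn V ends A `` {z}}"
    using assms by blast
  then have "V // conn V ends A = {conn V ends A `` {z}}"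
    unfolding quotient_def UNION_singleton_eq_range .
  then show "ncomp V ends A = 1" by (simp add: ncomp_def)
qed

lemma nonloop_edge_exists:
  assumes "ncomp V ends A = 1" "v \<in> V" "z \<in> V" "v \<noteq> z"
  shows "\<exists>e\<in>A. v \<in> ends e \<and> ends e \<noteq> {v}"
proof (rule ccontr)
  assume none: "\<not> ?thesis"
  have "(z, v) \<in> conn V ends A" using assms ncomp_eq_1_iff[OF assms(2)] by blast
  then have "(v, z) \<in> (edge_rel ends A)\<^sup>*" using conn_sym[of z v V ends A] by (simp add: conn_def)
  then have "z = v"
  proof (induction rule: rtrancl_induct)
    case (step y z)
    then obtain e where "e \<in> A" "ends e = {v, z}" by (auto simp: edge_rel_def)
    then show ?case using none by auto
  qed simp
  then show False using assms by simp
qed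

text \<open>\<open>w\<close> is merged into \<open>x\<close> along \<open>e\<close>, and
  \<open>f\<close> takes over the ends \<open>x\<close> and \<open>y\<close>, becoming a loop if
  these coincide. As \<open>e\<close> has been contracted, an edge set \<open>A\<close> of the
  smaller graph corresponds to \<open>insert e A\<close>, whether or not \<open>A\<close> contains
  \<open>f\<close>.\<close>

lemma ncomp_suppress:
  assumes G: "multigraph V E ends" and ef: "e \<in> E" "f \<in> E" "e \<noteq> f"
    and e: "ends e = {w, x}" "x \<noteq> w" and f: "ends f = {w, y}" "y \<noteq> w"
    and deg: "\<And>g. g \<in> E \<Longrightarrow> w \<in> ends g \<Longrightarrow> g = e \<or> g = f"
    and A: "A \<subseteq> E - {e}"
  shows "ncomp (V - {w}) (ends(f := {x, y})) A = ncomp V ends (insert e A)"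
proof (rule ncomp_eq_of_retraction)
  have V: "w \<in> V" "x \<in> V" "y \<in> V" using G ef e f by (auto simp: multigraph_def)
  let ?p = "\<lambda>v. if v = w then x else v"
  show "multigraph V (insert e A) ends" by (rule multigraph_subset[OF G]) (use A ef in auto)
  show "multigraph (V - {w}) A (ends(f := {x, y}))"
    unfolding multigraph_def
  proof (intro conjI ballI)
    show "finite (V - {w})" "finite A"
      using multigraph_finite[OF G] A finite_subset[of A E] by auto
    fix g assume g: "g \<in> A"
    then have gE: "g \<in> E" "g \<noteq> e" using A by auto
    show "(ends(f := {x, y})) g \<subseteq> V - {w}"
      using G gE deg[of g] V e f by (auto simp: multigraph_def)
    show "1 \<le> card ((ends(f := {x, y})) g)" "card ((ends(f := {x, y})) g) \<le> 2"
      using G gE by (auto simp: multigraph_def card_insert_if)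
  qed
  show "?p ` V \<subseteq> V - {w}" using V e by auto
  show "id ` (V - {w}) \<subseteq> V" by auto
  show "?p (id s) = s" if "s \<in> V - {w}" for s using that by auto
  show "(v, id (?p v)) \<in> conn V ends (insert e A)" if "v \<in> V" for v
    using that V e by (auto intro: conn_refl conn_edge[of e])
  show "(?p a, ?p b) \<in> conn (V - {w}) (ends(f := {x, y})) A"
    if g: "g \<in> insert e A" "ends g = {a, b}" "a \<in> V" "b \<in> V" for g a b
  proof -
    consider "g = e" | "g = f" "f \<in> A" | "g \<in> A" "g \<noteq> f" "g \<noteq> e" using g by auto
    then show ?thesis
    proof cases
      case 1
      then have "?p a = x" "?p b = x" using g e by (auto simp: doubleton_eq_iff)
      then show ?thesis using V e by (auto intro: conn_refl)
    next
      case 2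
      then have "{?p a, ?p b} = {x, y}" using g f by (auto simp: doubleton_eq_iff)
      then show ?thesis using 2 V e f g by (intro conn_edge[of f]) auto
    next
      case 3
      then have "w \<notin> ends g" using deg[of g] A by auto
      then have ab: "a \<noteq> w" "b \<noteq> w" using g by auto
      then have "(a, b) \<in> conn (V - {w}) (ends(f := {x, y})) A"
        using 3 g by (intro conn_edge[of g]) auto
      then show ?thesis using ab by simp
    qed
  qed
  show "(id a, id b) \<in> conn V ends (insert e A)"
    if g: "g \<in> A" "(ends(f := {x, y})) g = {a, b}" "a \<in> V - {w}" "b \<in> V - {w}" for g a b
  proof (cases "g = f")
    case True
    have "(w, x) \<in> conn V ends (insert e A)" using e V by (intro conn_edge[of e]) auto
    moreover have "(w, y) \<in> conn V ends (insert e A)" using f V g True by (intro conn_edge[of f]) auto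
    moreover have "a = x \<and> b = y \<or> a = y \<and> b = x" using g True by (auto simp: doubleton_eq_iff)
    ultimately show ?thesis by (elim disjE conjE) (auto intro: conn_sym conn_trans)
  next
    case False
    then show ?thesis using g by (intro conn_edge[of g]) auto
  qed
qed

text \<open>Some vertex has at most two incident edges. Connectedness gives it a non-loop edge
  \<open>e\<close>, and connectedness of \<open>G - e\<close>, which is due to bridgelessness, gives
  it a second one, so there are no others.\<close>

lemma degree_two_vertex_exists:
  assumes G: "multigraph V E ends" and b: "bridgeless V E ends" and conn: "ncomp V ends E = 1"
    and card: "card E = card V + 1" "3 \<le> card V"
  obtains w e f x y where "e \<in> E" "f \<in> E" "e \<noteq> f" "ends e = {w, x}" "x \<noteq> w" "ends f = {w, y}" "y \<noteq> w"
    "\<And>g. g \<in> E \<Longrightarrow> w \<in> ends g \<Longrightarrow> g = e \<or> g = f"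
proof -
  let ?D = "\<lambda>v. {g. g \<in> E \<and> v \<in> ends g}"
  have fin: "finite V" "finite E" using multigraph_finite[OF G] .
  \<comment> \<open>Otherwise counting incidences gives 3 n <= 2 (n + 1), that is n <= 2. A loop is
    counted once here, which keeps the upper bound valid.\<close>
  have "\<exists>w\<in>V. card (?D w) \<le> 2"
  proof (rule ccontr)
    assume "\<not> ?thesis"
    then have "3 * card V \<le> (\<Sum>v\<in>V. card (?D v))"
      using sum_mono[of V "\<lambda>_. 3" "\<lambda>v. card (?D v)"] by fastforce
    also have "\<dots> = (\<Sum>v\<in>V. \<Sum>g | g \<in> E \<and> v \<in> ends g. 1)" by simp
    also have "\<dots> = (\<Sum>g\<in>E. \<Sum>v | v \<in> V \<and> v \<in> ends g. 1)" by (rule sum.swap_restrict[OF fin])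
    also have "\<dots> \<le> (\<Sum>g\<in>E. 2)"
    proof (rule sum_mono)
      fix g assume "g \<in> E"
      then have "{v. v \<in> V \<and> v \<in> ends g} = ends g" "card (ends g) \<le> 2"
        using G by (auto simp: multigraph_def)
      then show "(\<Sum>v | v \<in> V \<and> v \<in> ends g. 1) \<le> (2::nat)" by simp
    qed
    finally show False using card by simp
  qed
  then obtain w where w: "w \<in> V" "card (?D w) \<le> 2" by blast
  have "card (V - {w}) \<ge> 2" using card w fin by simp
  then have "V - {w} \<noteq> {}" by (metis card.empty not_numeral_le_zero)
  then obtain z where z: "z \<in> V" "w \<noteq> z" by blast
  obtain e where e: "e \<in> E" "w \<in> ends e" "ends e \<noteq> {w}"
    using nonloop_edge_exists[OF conn w(1) z] by blast
  have "ncomp V ends (E - {e}) = 1" using b e conn by (simp add: bridgeless_def)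
  then obtain f where f: "f \<in> E - {e}" "w \<in> ends f" "ends f \<noteq> {w}"
    using nonloop_edge_exists[OF _ w(1) z] by blast
  have ends: "\<exists>x. ends g = {w, x} \<and> x \<noteq> w" if g: "g \<in> E" "w \<in> ends g" "ends g \<noteq> {w}" for g
  proof -
    obtain a b where "ends g = {a, b}" using multigraph_ends[OF G g(1)] by blast
    then show ?thesis using g(2,3) by (cases "a = w") (auto simp: insert_commute)
  qed
  obtain x where x: "ends e = {w, x}" "x \<noteq> w" using ends e by blast
  obtain y where y: "ends f = {w, y}" "y \<noteq> w" using ends f by blast
  have "{e, f} = ?D w"
    by (rule card_seteq) (use fin e f w in auto)
  then show ?thesis using that[of e f w x y] e f x y by blast
qed

section \<open>Walks and subdivided theta graphs\<close>

fun walk :: "('e \<Rightarrow> 'v set) \<Rightarrow> 'v \<Rightarrow> ('e \<times> 'v) list \<Rightarrow> 'v \<Rightarrow> bool" where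
  "walk ends u [] v \<longleftrightarrow> u = v"
| "walk ends u ((e, x) # p) v \<longleftrightarrow> ends e = {u, x} \<and> walk ends x p v"

lemma walk_append: "walk ends u (p @ q) v \<longleftrightarrow> (\<exists>s. walk ends u p s \<and> walk ends s q v)"
  by (induction p arbitrary: u) auto

lemma walk_fun_upd: "f \<notin> fst ` set p \<Longrightarrow> walk (ends(f := S)) u p v \<longleftrightarrow> walk ends u p v"
  by (induction p arbitrary: u) auto

lemma walk_nth:
  "walk ends u p v \<Longrightarrow> j < length p \<Longrightarrow>
    ends (fst (p ! j)) = {if j = 0 then u else snd (p ! (j - 1)), snd (p ! j)}"
proof (induction p arbitrary: u j)
  case (Cons a p)
  obtain e x where a: "a = (e, x)" by (cases a)
  show ?case
  proof (cases j)
    case (Suc i)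
    then show ?thesis using Cons.IH[of x i] Cons.prems a by (cases i) auto
  qed (use Cons a in auto)
qed simp

lemma walk_last: "walk ends u p v \<Longrightarrow> p \<noteq> [] \<Longrightarrow> snd (p ! (length p - 1)) = v"
proof (induction p arbitrary: u)
  case (Cons a p)
  then show ?case by (cases a; cases p) auto
qed simp

abbreviation inner :: "('e \<times> 'v) list \<Rightarrow> 'v list" where
  "inner p \<equiv> butlast (map snd p)"

text \<open>The two \<open>distinct\<close> lists say that the paths share no edge and no inner
  vertex, and that \<open>u\<close> and \<open>v\<close> differ. Unlike an isomorphism with the
  standard theta graph, this form lets an edge be subdivided by splitting a list.\<close>

definition theta_paths ::
  "'v set \<Rightarrow> 'e set \<Rightarrow> ('e \<Rightarrow> 'v set) \<Rightarrow> 'v \<Rightarrow> 'v \<Rightarrow>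
    ('e \<times> 'v) list \<Rightarrow> ('e \<times> 'v) list \<Rightarrow> ('e \<times> 'v) list \<Rightarrow> bool" where
  "theta_paths V E ends u v p1 p2 p3 \<longleftrightarrow>
     p1 \<noteq> [] \<and> p2 \<noteq> [] \<and> p3 \<noteq> [] \<and>
     walk ends u p1 v \<and> walk ends u p2 v \<and> walk ends u p3 v \<and>
     E = fst ` set p1 \<union> fst ` set p2 \<union> fst ` set p3 \<and> distinct (map fst p1 @ map fst p2 @ map fst p3) \<and>
     V = {u, v} \<union> set (inner p1) \<union> set (inner p2) \<union> set (inner p3) \<and>
     distinct (u # v # inner p1 @ inner p2 @ inner p3)"

lemma theta_paths_swap12:
  "theta_paths V E ends u v p1 p2 p3 \<Longrightarrow> theta_paths V E ends u v p2 p1 p3"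
  unfolding theta_paths_def by auto

lemma theta_paths_swap13:
  "theta_paths V E ends u v p1 p2 p3 \<Longrightarrow> theta_paths V E ends u v p3 p2 p1"
  unfolding theta_paths_def by auto

text \<open>Undoes the suppression of \<open>ncomp_suppress\<close> by putting \<open>w\<close> back
  on the edge \<open>f\<close>. The first path may be assumed to contain \<open>f\<close>, since the
  three paths can be exchanged.\<close>

lemma theta_paths_subdivide:
  assumes P: "theta_paths (V - {w}) (E - {e}) (ends(f := {x, y})) u v p1 p2 p3"
    and f1: "f \<in> fst ` set p1" and w: "w \<in> V"
    and ef: "e \<in> E" "e \<noteq> f" "ends e = {w, x}" "ends f = {w, y}"
  shows "\<exists>p. theta_paths V E ends u v p p2 p3"
proof -
  obtain t where "(f, t) \<in> set p1" using f1 by auto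
  then obtain xs ys where p1: "p1 = xs @ (f, t) # ys" by (meson split_list)
  have dist: "distinct (map fst p1 @ map fst p2 @ map fst p3)"
    "distinct (u # v # inner p1 @ inner p2 @ inner p3)"
    and E: "E - {e} = fst ` set p1 \<union> fst ` set p2 \<union> fst ` set p3"
    and V: "V - {w} = {u, v} \<union> set (inner p1) \<union> set (inner p2) \<union> set (inner p3)"
    and ne: "p2 \<noteq> []" "p3 \<noteq> []"
    and walks: "walk (ends(f := {x, y})) u p1 v" "walk (ends(f := {x, y})) u p2 v"
      "walk (ends(f := {x, y})) u p3 v"
    using P unfolding theta_paths_def by blast+
  have fnot: "f \<notin> fst ` set xs" "f \<notin> fst ` set ys" "f \<notin> fst ` set p2" "f \<notin> fst ` set p3"
    using dist(1) p1 by auto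
  obtain s where s: "walk ends u xs s" "{x, y} = {s, t}" "walk ends t ys v"
    using walks(1) p1 fnot by (auto simp: walk_append walk_fun_upd)
  \<comment> \<open>The walk may traverse \<open>f\<close> from \<open>x\<close> to \<open>y\<close>
    or from \<open>y\<close> to \<open>x\<close>; this decides which of \<open>e\<close> and
    \<open>f\<close> comes first.\<close>
  obtain g h where gh: "{g, h} = {e, f}" "ends g = {s, w}" "ends h = {w, t}"
  proof (cases "s = x \<and> t = y")
    case True
    then show ?thesis using that[of e f] ef by (auto simp: insert_commute)
  next
    case False
    then have "s = y" "t = x" using s(2) by (auto simp: doubleton_eq_iff)
    then show ?thesis using that[of f e] ef by (auto simp: insert_commute)
  qed
  let ?p = "xs @ (g, w) # (h, t) # ys"
  \<comment> \<open>Keeping \<open>t\<close> under \<open>butlast\<close> covers an empty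
    \<open>ys\<close> as well: then \<open>t\<close> is the final vertex \<open>v\<close> and is
    dropped.\<close>
  have in': "inner ?p = map snd xs @ w # butlast (t # map snd ys)" by (simp add: butlast_append)
  have in1: "inner p1 = map snd xs @ butlast (t # map snd ys)" using p1 by (simp add: butlast_append)
  have enot: "e \<notin> fst ` set p1" "e \<notin> fst ` set p2" "e \<notin> fst ` set p3" using E by auto
  have wnot: "w \<noteq> u" "w \<noteq> v" "w \<notin> set (inner p1)" "w \<notin> set (inner p2)" "w \<notin> set (inner p3)" using V by auto
  have "theta_paths V E ends u v ?p p2 p3"
    unfolding theta_paths_def
  proof (intro conjI)
    show "walk ends u ?p v" using s gh by (auto simp: walk_append)
    show "walk ends u p2 v" "walk ends u p3 v" using walks fnot by (auto simp: walk_fun_upd)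
    have "fst ` set ?p = insert e (fst ` set p1)" using gh(1) p1 by auto
    then have "fst ` set ?p \<union> fst ` set p2 \<union> fst ` set p3 = insert e (E - {e})"
      unfolding E by blast
    then show "E = fst ` set ?p \<union> fst ` set p2 \<union> fst ` set p3"
      unfolding insert_Diff[OF ef(1)] by (rule sym)
    have "{u, v} \<union> set (inner ?p) \<union> set (inner p2) \<union> set (inner p3) = insert w (V - {w})"
      unfolding V in' in1 set_append list.set(2) by blast
    then show "V = {u, v} \<union> set (inner ?p) \<union> set (inner p2) \<union> set (inner p3)"
      unfolding insert_Diff[OF w] by (rule sym)
    show "distinct (u # v # inner ?p @ inner p2 @ inner p3)"
      using dist(2) wnot unfolding in' in1 by auto
    have "g = e \<and> h = f \<or> g = f \<and> h = e" using gh(1) by (auto simp: doubleton_eq_iff)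
    then show "distinct (map fst ?p @ map fst p2 @ map fst p3)"
      using dist(1) enot ef(2) unfolding p1 by auto
  qed (use ne in auto)
  then show ?thesis by blast
qed

text \<open>Without \<open>X\<close> the graph could also consist of two cycles sharing a vertex,
  the other kind of connected bridgeless graph of nullity two; that graph has only two series
  classes. The induction therefore has to carry three pairwise non-series edges along.\<close>

lemma theta_paths_exist:
  assumes "multigraph V E ends" "bridgeless V E ends" "ncomp V ends E = 1" "card E = card V + 1"
    and "X \<subseteq> E" "card X = 3"
    and "\<And>a b. a \<in> X \<Longrightarrow> b \<in> X \<Longrightarrow> a \<noteq> b \<Longrightarrow> ncomp V ends (E - {a, b}) = 1"
  shows "\<exists>u v p1 p2 p3. theta_paths V E ends u v p1 p2 p3"
  using assms
proof (induction "card V" arbitrary: V E ends X rule: less_induct)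
  case less
  note G = less.prems(1) and br = less.prems(2) and conn = less.prems(3) and cardE = less.prems(4)
    and X = less.prems(5,6) and pair = less.prems(7)
  have fin: "finite V" "finite E" using multigraph_finite[OF G] .
  show ?case
  proof (cases "3 \<le> card V")
    case False
    \<comment> \<open>Three edges and at most two vertices force two vertices and
      \<open>X = E\<close>. The complement of each pair is then a single edge that connects the
      graph, so all three edges join \<open>u\<close> and \<open>v\<close>.\<close>
    have "3 \<le> card E" using X fin card_mono by metis
    then have "card V = 2" using False cardE by simp
    then obtain u v where uv: "V = {u, v}" "u \<noteq> v" by (auto simp: card_2_iff)
    have "X = E" using X fin cardE \<open>card V = 2\<close> by (intro card_seteq) auto
    then obtain a b c where abc: "E = {a, b, c}" "a \<noteq> b" "a \<noteq> c" "b \<noteq> c"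
      using X(2) by (auto simp: card_3_iff)
    have ends: "ends g = {u, v}" if "ncomp V ends {g} = 1" "g \<in> E" for g
    proof -
      have "u \<in> ends g" "v \<in> ends g"
        using nonloop_edge_exists[OF that(1), of u v] nonloop_edge_exists[OF that(1), of v u] uv by auto
      moreover have "ends g \<subseteq> {u, v}" using G that(2) uv by (auto simp: multigraph_def)
      ultimately show ?thesis by auto
    qed
    have "E - {b, c} = {a}" "E - {a, c} = {b}" "E - {a, b} = {c}" using abc by auto
    then have "ends a = {u, v}" "ends b = {u, v}" "ends c = {u, v}"
      using pair[of b c] pair[of a c] pair[of a b] \<open>X = E\<close> abc ends by auto
    then have "theta_paths V E ends u v [(a, v)] [(b, v)] [(c, v)]"
      using abc uv by (auto simp: theta_paths_def)
    then show ?thesis by blast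
  next
    case True
    obtain w e f x y where ef: "e \<in> E" "f \<in> E" "e \<noteq> f"
      and e: "ends e = {w, x}" "x \<noteq> w" and f: "ends f = {w, y}" "y \<noteq> w"
      and deg: "\<And>g. g \<in> E \<Longrightarrow> w \<in> ends g \<Longrightarrow> g = e \<or> g = f"
      by (rule degree_two_vertex_exists[OF G br conn cardE True]) blast
    have V: "w \<in> V" "x \<in> V" "y \<in> V" using G ef e f by (auto simp: multigraph_def)
    let ?V = "V - {w}" and ?E = "E - {e}" and ?ends = "ends(f := {x, y})"
    have nc: "ncomp ?V ?ends A = ncomp V ends (insert e A)" if "A \<subseteq> ?E" for A
      using ncomp_suppress[OF G ef e f deg that] .
    have nc': "ncomp ?V ?ends (?E - B) = ncomp V ends (E - B)" if "e \<notin> B" for B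
    proof -
      have "insert e (?E - B) = E - B" using ef that by auto
      then show ?thesis using nc[of "?E - B"] by auto
    qed
    have nc0: "ncomp ?V ?ends ?E = ncomp V ends E" using nc'[of "{}"] by simp
    \<comment> \<open>Without \<open>e\<close> and \<open>f\<close> the vertex \<open>w\<close> is
      isolated, so these two edges are in series.\<close>
    have ser: "ncomp V ends (E - {e, f}) \<noteq> 1"
      using nonloop_edge_exists[of V ends "E - {e, f}" w x] V e deg by auto
    interpret bridgeless_graph V E ends using G br by unfold_locales
    have rank2: "dual_rank V E ends {a, b} = 2 \<longleftrightarrow> ncomp V ends (E - {a, b}) = 1"
      if "a \<in> E" "b \<in> E" "a \<noteq> b" for a b
      using dual_rank_eq[OF G, of "{a, b}"] that conn by auto
    \<comment> \<open>Being in series is transitive, by \<open>cl_eq_iff\<close>, so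
      \<open>f\<close> can represent the series class of \<open>e\<close>.\<close>
    have par: "ncomp V ends (E - {f, a}) = 1" if "e \<in> X" "a \<in> X" "a \<noteq> e" for a
    proof -
      have aE: "a \<in> E" using that X by auto
      have "a \<noteq> f" using pair[OF that(1,2)] that(3) ser by auto
      have "dual_rank V E ends {e, a} = 2" using pair[OF that(1,2)] that(3) rank2[OF ef(1) aE] by auto
      moreover have "dual_rank V E ends {e, f} = 1"
        using rank2[OF ef] ser dual.rank_pair_cases[OF ef(1,2)] by auto
      ultimately have "dual_rank V E ends {f, a} \<noteq> 1"
        using dual.cl_eq_iff[OF ef(1) aE] dual.cl_eq_iff[OF ef(1,2)] dual.cl_eq_iff[OF ef(2) aE] by simp
      then show ?thesis
        using rank2[OF ef(2) aE] \<open>a \<noteq> f\<close> dual.rank_pair_cases[OF ef(2) aE] by auto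
    qed
    \<comment> \<open>If \<open>X\<close> contains the contracted edge \<open>e\<close>, then
      \<open>f\<close> takes its place; \<open>f\<close> was not in \<open>X\<close> in that case,
      since it is in series with \<open>e\<close>.\<close>
    define Y where "Y = (if e \<in> X then insert f (X - {e}) else X)"
    have finX: "finite X" using X fin finite_subset by auto
    have "f \<notin> X" if "e \<in> X" using pair[OF that, of f] ser ef(3) by auto
    then have Y: "Y \<subseteq> ?E" "card Y = 3"
      using X ef finX unfolding Y_def by (auto simp: card_insert_if)
    have "\<exists>u v p1 p2 p3. theta_paths ?V ?E ?ends u v p1 p2 p3"
    proof (rule less.hyps[OF _ _ _ _ _ Y])
      show "card ?V < card V" using V fin by (meson card_Diff1_less)
      show "ncomp ?V ?ends ?E = 1" using nc0 conn by simp
      show "card ?E = card ?V + 1" using cardE V ef fin True by simp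
      show "bridgeless ?V ?E ?ends"
        unfolding bridgeless_def
      proof
        fix g assume "g \<in> ?E"
        then show "ncomp ?V ?ends (?E - {g}) = ncomp ?V ?ends ?E"
          using nc'[of "{g}"] nc0 br by (auto simp: bridgeless_def)
      qed
      show "multigraph ?V ?E ?ends"
        unfolding multigraph_def
      proof (intro conjI ballI)
        fix g assume g: "g \<in> ?E"
        show "?ends g \<subseteq> ?V"
          using G g deg[of g] V e f by (auto simp: multigraph_def)
        show "1 \<le> card (?ends g)" "card (?ends g) \<le> 2"
          using G g by (auto simp: multigraph_def card_insert_if)
      qed (use fin in auto)
      show "ncomp ?V ?ends (?E - {a, b}) = 1" if ab: "a \<in> Y" "b \<in> Y" "a \<noteq> b" for a b
      proof -
        have "e \<notin> {a, b}" using ab Y by auto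
        moreover have "ncomp V ends (E - {a, b}) = 1"
        proof (cases "e \<in> X")
          case False
          then show ?thesis using pair ab by (simp add: Y_def)
        next
          case True
          then consider "a = f" "b \<in> X" "b \<noteq> e" | "b = f" "a \<in> X" "a \<noteq> e" | "a \<in> X" "b \<in> X"
            using ab by (auto simp: Y_def)
          then show ?thesis using par[OF True] pair ab(3) by cases (auto simp: insert_commute)
        qed
        ultimately show ?thesis using nc' by simp
      qed
    qed
    then obtain u v p1 p2 p3 where P: "theta_paths ?V ?E ?ends u v p1 p2 p3" by blast
    have "f \<in> fst ` set p1 \<union> fst ` set p2 \<union> fst ` set p3"
      using P ef unfolding theta_paths_def by blast
    then consider "f \<in> fst ` set p1" | "f \<in> fst ` set p2" | "f \<in> fst ` set p3" by blast
    then show ?thesis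
    proof cases
      case 1
      then show ?thesis
        using theta_paths_subdivide[OF P _ V(1) ef(1,3) e(1) f(1)] by blast
    next
      case 2
      then show ?thesis
        using theta_paths_subdivide[OF theta_paths_swap12[OF P] _ V(1) ef(1,3) e(1) f(1)] by blast
    next
      case 3
      then show ?thesis
        using theta_paths_subdivide[OF theta_paths_swap13[OF P] _ V(1) ef(1,3) e(1) f(1)] by blast
    qed
  qed
qed

section \<open>Comparison with the standard theta graph\<close>

lemma graph_iso_sym:
  assumes "graph_iso V1 E1 ends1 V2 E2 ends2" "\<And>e. e \<in> E1 \<Longrightarrow> ends1 e \<subseteq> V1"
  shows "graph_iso V2 E2 ends2 V1 E1 ends1"
proof -
  obtain \<phi> \<psi> where \<phi>: "bij_betw \<phi> V1 V2" and \<psi>: "bij_betw \<psi> E1 E2"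
    and ends: "\<And>e. e \<in> E1 \<Longrightarrow> ends2 (\<psi> e) = \<phi> ` ends1 e"
    using assms(1) unfolding graph_iso_def by blast
  have "ends1 (inv_into E1 \<psi> f) = inv_into V1 \<phi> ` ends2 f" if "f \<in> E2" for f
  proof -
    let ?e = "inv_into E1 \<psi> f"
    have e: "?e \<in> E1" "\<psi> ?e = f"
      using that \<psi> by (auto simp: bij_betw_def intro: inv_into_into f_inv_into_f)
    have "ends2 f = \<phi> ` ends1 ?e" using ends[OF e(1)] e(2) by simp
    then show ?thesis
      using inv_into_image_cancel[of \<phi> V1 "ends1 ?e"] assms(2)[OF e(1)] \<phi> by (simp add: bij_betw_def)
  qed
  then show ?thesis
    unfolding graph_iso_def using bij_betw_inv_into[OF \<phi>] bij_betw_inv_into[OF \<psi>] by metis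
qed

lemma theta_E_Sigma: "theta_E k1 k2 k3 = Sigma {1, 2, 3} (\<lambda>i. {1..theta_len k1 k2 k3 i})"
  by (auto simp: theta_E_def)

lemma theta_V_Sigma:
  "theta_V k1 k2 k3 = {(0, 0), (0, 1)} \<union> Sigma {1, 2, 3} (\<lambda>i. {1..<theta_len k1 k2 k3 i})"
  by (auto simp: theta_V_def)

lemma finite_theta_E: "finite (theta_E k1 k2 k3)"
  and finite_theta_V: "finite (theta_V k1 k2 k3)"
  by (simp_all add: theta_E_Sigma theta_V_Sigma)

lemma card_theta_E: "card (theta_E k1 k2 k3) = k1 + k2 + k3"
  by (simp add: theta_E_Sigma card_SigmaI theta_len_def)

lemma card_theta_V: "card (theta_V k1 k2 k3) = 2 + ((k1 - 1) + (k2 - 1) + (k3 - 1))"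
proof -
  have "card (theta_V k1 k2 k3) = card {(0::nat, 0::nat), (0, 1)}
      + card (Sigma {1::nat, 2, 3} (\<lambda>i. {1..<theta_len k1 k2 k3 i}))"
    unfolding theta_V_Sigma by (rule card_Un_disjoint) auto
  also have "card (Sigma {1::nat, 2, 3} (\<lambda>i. {1..<theta_len k1 k2 k3 i})) = (k1 - 1) + (k2 - 1) + (k3 - 1)"
    by (simp add: card_SigmaI theta_len_def)
  finally show ?thesis by simp
qed

lemma theta_pos_in_V: "i \<in> {1, 2, 3} \<Longrightarrow> j \<le> theta_len k1 k2 k3 i \<Longrightarrow> theta_pos k1 k2 k3 i j \<in> theta_V k1 k2 k3"
  by (auto simp: theta_pos_def theta_V_def)

text \<open>List positions start at 0, but the edges of a theta path are numbered from 1.\<close>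

lemma image_set_eq_nth_image: "h ` set p = (\<lambda>j. h (p ! (j - 1))) ` {1..length p}"
proof -
  have "h ` set p = (\<lambda>j. h (p ! j)) ` {..<length p}"
    by (auto simp: set_conv_nth image_iff)
  also have "\<dots> = (\<lambda>j. h (p ! (j - 1))) ` Suc ` {..<length p}" by (simp add: image_image)
  also have "Suc ` {..<length p} = {1..length p}"
    by (simp add: lessThan_atLeast0 image_Suc_atLeastLessThan atLeastLessThanSuc_atLeastAtMost)
  finally show ?thesis .
qed

lemma set_inner_eq: "set (inner p) = (\<lambda>j. snd (p ! (j - 1))) ` {1..<length p}"
proof -
  have "set (inner p) = snd ` set (butlast p)" by (simp add: map_butlast[symmetric])
  also have "\<dots> = (\<lambda>j. snd (butlast p ! (j - 1))) ` {1..length p - 1}"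
    unfolding image_set_eq_nth_image by simp
  also have "\<dots> = (\<lambda>j. snd (p ! (j - 1))) ` {1..<length p}"
    by (rule image_cong) (auto simp: nth_butlast)
  finally show ?thesis .
qed

lemma image_Sigma: "f ` Sigma I J = (\<Union>i\<in>I. (\<lambda>j. f (i, j)) ` J i)"
  by blast

text \<open>The maps \<open>g\<close> and \<open>h\<close> are onto, and the \<open>distinct\<close>
  lists make the cardinalities agree; a surjection between finite sets of equal size is bijective,
  which spares a direct proof of injectivity.\<close>

lemma theta_paths_imp_iso:
  assumes "theta_paths V E ends u v p1 p2 p3"
  defines "k1 \<equiv> length p1" and "k2 \<equiv> length p2" and "k3 \<equiv> length p3"
  shows "graph_iso (theta_V k1 k2 k3) (theta_E k1 k2 k3) (theta_ends k1 k2 k3) V E ends"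
proof -
  define P where "P i = (if i = 1 then p1 else if i = 2 then p2 else p3)" for i :: nat
  define g where "g = (\<lambda>(i, j). fst (P i ! (j - 1)))"
  define h where "h = (\<lambda>(i, j). if i = 0 then (if j = 0 then u else v) else snd (P i ! (j - 1)))"
  have len: "theta_len k1 k2 k3 i = length (P i)" for i
    by (simp add: theta_len_def P_def k1_def k2_def k3_def)
  have ne: "P i \<noteq> []" and walk: "walk ends u (P i) v" for i
    using assms(1) by (auto simp: P_def theta_paths_def)
  have E: "E = fst ` set p1 \<union> fst ` set p2 \<union> fst ` set p3"
    and V: "V = {u, v} \<union> set (inner p1) \<union> set (inner p2) \<union> set (inner p3)"
    and dE: "distinct (map fst p1 @ map fst p2 @ map fst p3)"
    and dV: "distinct (u # v # inner p1 @ inner p2 @ inner p3)"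
    using assms(1) unfolding theta_paths_def by blast+
  have P123: "P 1 = p1" "P 2 = p2" "P 3 = p3" by (simp_all add: P_def)
  have imE: "g ` theta_E k1 k2 k3 = E"
  proof -
    have "g ` theta_E k1 k2 k3 = (\<Union>i\<in>{1, 2, 3}. (\<lambda>j. fst (P i ! (j - 1))) ` {1..length (P i)})"
      unfolding theta_E_Sigma len image_Sigma by (simp add: g_def)
    then show ?thesis
      unfolding E image_set_eq_nth_image[of fst, symmetric] by (simp add: P123[simplified] Un_assoc)
  qed
  have imV: "h ` theta_V k1 k2 k3 = V"
  proof -
    have "h ` theta_V k1 k2 k3
        = {u, v} \<union> (\<Union>i\<in>{1, 2, 3}. (\<lambda>j. snd (P i ! (j - 1))) ` {1..<length (P i)})"
      unfolding theta_V_Sigma len image_Sigma image_Un by (simp add: h_def)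
    then show ?thesis
      unfolding V set_inner_eq[symmetric] by (simp add: P123[simplified] Un_assoc)
  qed
  have "card E = length (map fst p1 @ map fst p2 @ map fst p3)"
    unfolding distinct_card[OF dE, symmetric] E by (simp add: Un_assoc)
  then have "card E = card (theta_E k1 k2 k3)"
    by (simp add: card_theta_E k1_def k2_def k3_def)
  then have bijE: "bij_betw g (theta_E k1 k2 k3) E"
    unfolding bij_betw_def using imE eq_card_imp_inj_on[OF finite_theta_E, of g] by simp
  have "card V = length (u # v # inner p1 @ inner p2 @ inner p3)"
    unfolding distinct_card[OF dV, symmetric] V by (simp add: Un_assoc)
  then have "card V = card (theta_V k1 k2 k3)"
    by (simp add: card_theta_V k1_def k2_def k3_def)
  then have bijV: "bij_betw h (theta_V k1 k2 k3) V"
    unfolding bij_betw_def using imV eq_card_imp_inj_on[OF finite_theta_V, of h] by simp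
  \<comment> \<open>The last position of every path is the common vertex \<open>(0, 1)\<close>,
    whereas each walk stores its own last vertex; \<open>walk_last\<close> reconciles the
    two.\<close>
  have pos: "h (theta_pos k1 k2 k3 i j) = (if j = 0 then u else snd (P i ! (j - 1)))"
    if "i \<in> {1, 2, 3}" for i j
    using that walk_last[OF walk ne, of i] by (auto simp: h_def theta_pos_def len)
  have "ends (g t) = h ` theta_ends k1 k2 k3 t" if t: "t \<in> theta_E k1 k2 k3" for t
  proof -
    obtain i j where ij: "t = (i, j)" "i \<in> {1, 2, 3}" "1 \<le> j" "j \<le> length (P i)"
      using t unfolding theta_E_Sigma len by auto
    have "ends (fst (P i ! (j - 1))) = {if j - 1 = 0 then u else snd (P i ! (j - 1 - 1)), snd (P i ! (j - 1))}"
      using walk_nth[OF walk, of "j - 1" i] ij by auto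
    then show ?thesis
      using ij by (simp add: g_def theta_ends_def pos[OF ij(2)] del: One_nat_def)
  qed
  then show ?thesis unfolding graph_iso_def using bijE bijV by blast
qed

text \<open>The first edges of the three paths serve as \<open>X\<close>. With two of them removed,
  the third path still joins the two branch vertices, and every inner vertex reaches
  \<open>(0, 1)\<close> along the rest of its own path.\<close>

lemma theta_iso_imp_independent:
  assumes k: "1 \<le> k1" "1 \<le> k2" "1 \<le> k3"
    and "graph_iso (theta_V k1 k2 k3) (theta_E k1 k2 k3) (theta_ends k1 k2 k3) V E ends"
  shows "\<exists>X. X \<subseteq> E \<and> card X = 3 \<and>
    (\<forall>a\<in>X. \<forall>b\<in>X. a \<noteq> b \<longrightarrow> ncomp V ends (E - {a, b}) = 1)"
proof -
  obtain \<phi> \<psi> where \<phi>: "bij_betw \<phi> (theta_V k1 k2 k3) V" and \<psi>: "bij_betw \<psi> (theta_E k1 k2 k3) E"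
    and ends: "\<And>e. e \<in> theta_E k1 k2 k3 \<Longrightarrow> ends (\<psi> e) = \<phi> ` theta_ends k1 k2 k3 e"
    using assms(4) unfolding graph_iso_def by blast
  let ?len = "theta_len k1 k2 k3" and ?pos = "theta_pos k1 k2 k3"
  have len: "1 \<le> ?len i" for i using k by (simp add: theta_len_def)
  have \<phi>V: "\<phi> t \<in> V" if "t \<in> theta_V k1 k2 k3" for t using that \<phi> by (auto simp: bij_betw_def)
  have \<psi>E: "\<psi> t \<in> E" if "t \<in> theta_E k1 k2 k3" for t using that \<psi> by (auto simp: bij_betw_def)
  have \<psi>_eq: "\<psi> s = \<psi> t \<longleftrightarrow> s = t" if "s \<in> theta_E k1 k2 k3" "t \<in> theta_E k1 k2 k3" for s t
    using that \<psi> by (auto simp: bij_betw_def inj_on_def)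
  have inE: "(i, j) \<in> theta_E k1 k2 k3 \<longleftrightarrow> i \<in> {1, 2, 3} \<and> 1 \<le> j \<and> j \<le> ?len i" for i j
    by (auto simp: theta_E_def)
  \<comment> \<open>The way from position \<open>j\<close> to \<open>(0, 1)\<close> uses only edges
    with index above \<open>j\<close>, so a missing first edge matters only for
    \<open>j = 0\<close>.\<close>
  have path: "(\<phi> (?pos i j), \<phi> (0, 1)) \<in> conn V ends A"
    if i: "i \<in> {1, 2, 3}" and j: "j \<le> ?len i"
      and A: "\<And>l. j < l \<Longrightarrow> l \<le> ?len i \<Longrightarrow> \<psi> (i, l) \<in> A" for i j A
    using j A
  proof (induction rule: inc_induct)
    case base
    have "?pos i (?len i) = (0, 1)" using len[of i] by (simp add: theta_pos_def)
    then show ?case using \<phi>V by (auto intro: conn_refl simp: theta_V_def)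
  next
    case (step l)
    have "(i, Suc l) \<in> theta_E k1 k2 k3" using i step.hyps by (simp add: inE)
    then have "ends (\<psi> (i, Suc l)) = {\<phi> (?pos i l), \<phi> (?pos i (Suc l))}"
      by (simp add: ends theta_ends_def)
    moreover have "\<phi> (?pos i l) \<in> V" "\<phi> (?pos i (Suc l)) \<in> V"
      using \<phi>V theta_pos_in_V[OF i] step.hyps by auto
    moreover have "\<psi> (i, Suc l) \<in> A" using step by auto
    ultimately have "(\<phi> (?pos i l), \<phi> (?pos i (Suc l))) \<in> conn V ends A" by (intro conn_edge)
    moreover have "(\<phi> (?pos i (Suc l)), \<phi> (0, 1)) \<in> conn V ends A" using step by auto
    ultimately show ?case by (rule conn_trans)
  qed
  have conn1: "ncomp V ends (E - {\<psi> (a, 1), \<psi> (b, 1)}) = 1"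
    if ab: "a \<in> {1, 2, 3}" "b \<in> {1, 2, 3}" "a \<noteq> b" for a b
  proof -
    let ?A = "E - {\<psi> (a, 1), \<psi> (b, 1)}"
    have abE: "(a, 1) \<in> theta_E k1 k2 k3" "(b, 1) \<in> theta_E k1 k2 k3" using ab len by (auto simp: inE)
    have A: "\<psi> t \<in> ?A" if "t \<in> theta_E k1 k2 k3" "t \<noteq> (a, 1)" "t \<noteq> (b, 1)" for t
      using that \<psi>E \<psi>_eq abE by auto
    have "1 \<noteq> a \<and> 1 \<noteq> b \<or> 2 \<noteq> a \<and> 2 \<noteq> b \<or> 3 \<noteq> a \<and> 3 \<noteq> b" by presburger
    then obtain c where c: "c \<in> {1, 2, 3}" "c \<noteq> a" "c \<noteq> b" by blast
    have "(\<phi> t, \<phi> (0, 1)) \<in> conn V ends ?A" if t: "t \<in> theta_V k1 k2 k3" for t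
    proof -
      consider "t = (0, 0)" | "t = (0, 1)" | i j where "t = (i, j)" "i \<in> {1, 2, 3}" "1 \<le> j" "j < ?len i"
        using t unfolding theta_V_def by auto
      then show ?thesis
      proof cases
        case 1
        have "(\<phi> (?pos c 0), \<phi> (0, 1)) \<in> conn V ends ?A"
        proof (rule path[OF c(1)])
          fix l assume "0 < l" "l \<le> ?len c"
          then show "\<psi> (c, l) \<in> ?A" using c by (intro A) (auto simp: inE)
        qed simp
        then show ?thesis using 1 by (simp add: theta_pos_def)
      next
        case 2
        then show ?thesis using \<phi>V[OF t] by (auto intro: conn_refl)
      next
        case 3
        have "(\<phi> (?pos i j), \<phi> (0, 1)) \<in> conn V ends ?A"
        proof (rule path[OF 3(2)])
          fix l assume "j < l" "l \<le> ?len i"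
          then show "\<psi> (i, l) \<in> ?A" using 3 by (intro A) (auto simp: inE)
        qed (use 3 in simp)
        then show ?thesis using 3 by (simp add: theta_pos_def)
      qed
    qed
    moreover have "V = \<phi> ` theta_V k1 k2 k3" using \<phi> by (simp add: bij_betw_def)
    ultimately have "\<forall>x\<in>V. (x, \<phi> (0, 1)) \<in> conn V ends ?A" by blast
    moreover have "\<phi> (0, 1) \<in> V" using \<phi>V by (auto simp: theta_V_def)
    ultimately show ?thesis using ncomp_eq_1_iff[of "\<phi> (0, 1)" V ends ?A] by simp
  qed
  have sub: "(\<lambda>i. (i, 1)) ` {1, 2, 3} \<subseteq> theta_E k1 k2 k3" using len by (auto simp: inE)
  have inj: "inj_on (\<lambda>i. \<psi> (i, 1)) {1, 2, 3}"
    using \<psi>_eq sub by (fastforce simp: inj_on_def)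
  let ?X = "(\<lambda>i. \<psi> (i, 1)) ` {1, 2, 3}"
  have "?X \<subseteq> E" using sub \<psi>E by blast
  moreover have "card ?X = 3" using card_image[OF inj] by simp
  moreover have "\<forall>a\<in>?X. \<forall>b\<in>?X. a \<noteq> b \<longrightarrow> ncomp V ends (E - {a, b}) = 1"
  proof (intro ballI impI)
    fix a b assume "a \<in> ?X" "b \<in> ?X" "a \<noteq> b"
    then obtain i j where "a = \<psi> (i, 1)" "b = \<psi> (j, 1)" "i \<in> {1, 2, 3}" "j \<in> {1, 2, 3}" by blast
    then show "ncomp V ends (E - {a, b}) = 1" using conn1[of i j] \<open>a \<noteq> b\<close> by blast
  qed
  ultimately show ?thesis by blast
qed

section \<open>Theta classes as lines with three points\<close>

context bridgeless_graph
begin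

text \<open>Both directions pass through three pairwise non-series edges of \<open>C\<close>.
  \<open>theta_iso_imp_independent\<close> yields them for a theta class, and
  \<open>card_points_le_3\<close> then excludes a fourth point; conversely, they are the set
  \<open>X\<close> that \<open>theta_paths_exist\<close> requires.\<close>

lemma theta_class_iff:
  assumes conn: "ncomp V ends E = 1"
  shows "theta_class V E ends C \<longleftrightarrow> dual.flat 2 C \<and> card (dual.points C) = 3"
proof -
  let ?H = "contract_V V E ends C" and ?h = "contract_ends V E ends C"
  \<comment> \<open>Connectedness of the contracted graph minus two edges can be tested in
    \<open>G\<close>, because only edges outside \<open>C\<close> have been contracted.\<close>
  have rank2: "ncomp ?H ?h (C - {a, b}) = 1 \<longleftrightarrow> dual_rank V E ends {a, b} = 2"
    if "C \<subseteq> E" "a \<in> C" "b \<in> C" "a \<noteq> b" for a b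
  proof -
    have "C - {a, b} \<union> (E - C) = E - {a, b}" using that by auto
    then have "ncomp ?H ?h (C - {a, b}) = ncomp V ends (E - {a, b})"
      using ncomp_contract[OF graph that(1), of "C - {a, b}"] by auto
    moreover have "{a, b} \<subseteq> E" using that by auto
    ultimately show ?thesis using dual_rank_eq[OF graph, of "{a, b}"] that conn by auto
  qed
  show ?thesis
  proof
    assume "theta_class V E ends C"
    then obtain k1 k2 k3 where C: "C \<subseteq> E" and k: "1 \<le> k1" "1 \<le> k2" "1 \<le> k3" "card C = k1 + k2 + k3"
      and nc: "ncomp V ends (E - C) = k1 + k2 + k3 - 1" and br: "bridgeless V (E - C) ends"
      and iso: "graph_iso ?H C ?h (theta_V k1 k2 k3) (theta_E k1 k2 k3) (theta_ends k1 k2 k3)"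
      unfolding theta_class_def by blast
    have "dual_rank V E ends C = 2" using dual_rank_eq[OF graph C] nc k conn by simp
    then have flat: "dual.flat 2 C" using C br by (simp add: dual_flat_iff)
    have "graph_iso (theta_V k1 k2 k3) (theta_E k1 k2 k3) (theta_ends k1 k2 k3) ?H C ?h"
      by (rule graph_iso_sym[OF iso]) (use multigraph_contract[OF graph C] in \<open>auto simp: multigraph_def\<close>)
    from theta_iso_imp_independent[OF k(1-3) this]
    obtain X where X: "X \<subseteq> C" "card X = 3" "\<forall>a\<in>X. \<forall>b\<in>X. a \<noteq> b \<longrightarrow> ncomp ?H ?h (C - {a, b}) = 1"
      by blast
    then have "\<forall>a\<in>X. \<forall>b\<in>X. a \<noteq> b \<longrightarrow> dual_rank V E ends {a, b} = 2" using rank2[OF C] by blast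
    then have "3 \<le> card (dual.points C)" unfolding dual.card_points_ge_iff[OF flat] using X by blast
    then show "dual.flat 2 C \<and> card (dual.points C) = 3"
      using card_points_le_3[OF conn flat] flat by simp
  next
    assume "dual.flat 2 C \<and> card (dual.points C) = 3"
    then have flat: "dual.flat 2 C" and c3: "3 \<le> card (dual.points C)" by auto
    have C: "C \<subseteq> E" "dual_rank V E ends C = 2" "bridgeless V (E - C) ends"
      using flat by (auto simp: dual_flat_iff)
    obtain X where X: "X \<subseteq> C" "card X = 3" "\<forall>a\<in>X. \<forall>b\<in>X. a \<noteq> b \<longrightarrow> dual_rank V E ends {a, b} = 2"
      using c3 unfolding dual.card_points_ge_iff[OF flat] by blast
    \<comment> \<open>The vertices of the contracted graph are the components of
      \<open>G - C\<close>, so rank two of \<open>C\<close> means nullity two of this graph.\<close>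
    have cardH: "card C = card ?H + 1"
      using dual_rank_eq[OF graph C(1)] C(2) conn by (simp add: ncomp_def contract_V_def)
    have ncE: "ncomp ?H ?h C = 1"
      using ncomp_contract[OF graph C(1), of C] conn C(1) by (simp add: Un_absorb1)
    have brH: "bridgeless ?H C ?h"
      unfolding bridgeless_def
    proof
      fix e assume e: "e \<in> C"
      have "C - {e} \<union> (E - C) = E - {e}" using e C(1) by auto
      then show "ncomp ?H ?h (C - {e}) = ncomp ?H ?h C"
        using ncomp_contract[OF graph C(1), of "C - {e}"] ncE conn bridgeless e C(1)
        by (auto simp: bridgeless_def)
    qed
    have "ncomp ?H ?h (C - {a, b}) = 1" if "a \<in> X" "b \<in> X" "a \<noteq> b" for a b
      using rank2[OF C(1)] that X by blast
    from theta_paths_exist[OF multigraph_contract[OF graph C(1)] brH ncE cardH X(1,2) this]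
    obtain u v p1 p2 p3 where P: "theta_paths ?H C ?h u v p1 p2 p3" by blast
    define k1 k2 k3 where "k1 = length p1" and "k2 = length p2" and "k3 = length p3"
    have k: "1 \<le> k1" "1 \<le> k2" "1 \<le> k3"
      using P by (auto simp: theta_paths_def k1_def k2_def k3_def Suc_le_eq)
    have iso: "graph_iso (theta_V k1 k2 k3) (theta_E k1 k2 k3) (theta_ends k1 k2 k3) ?H C ?h"
      using theta_paths_imp_iso[OF P] unfolding k1_def k2_def k3_def .
    then have "card (theta_E k1 k2 k3) = card C"
      unfolding graph_iso_def by (auto dest: bij_betw_same_card)
    then have cardC: "card C = k1 + k2 + k3" by (simp add: card_theta_E)
    have iso': "graph_iso ?H C ?h (theta_V k1 k2 k3) (theta_E k1 k2 k3) (theta_ends k1 k2 k3)"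
    proof (rule graph_iso_sym[OF iso])
      fix t assume "t \<in> theta_E k1 k2 k3"
      then obtain i j where "t = (i, j)" "i \<in> {1, 2, 3}" "1 \<le> j" "j \<le> theta_len k1 k2 k3 i"
        by (auto simp: theta_E_def)
      then show "theta_ends k1 k2 k3 t \<subseteq> theta_V k1 k2 k3"
        by (auto simp: theta_ends_def theta_pos_in_V)
    qed
    have "ncomp V ends (E - C) = k1 + k2 + k3 - 1"
      using cardH cardC by (simp add: ncomp_def contract_V_def)
    then show "theta_class V E ends C"
      unfolding theta_class_def using C k cardC iso' by blast
  qed
qed

end

section \<open>Coefficients of the Tutte polynomial\<close>

lemma const_poly_power: "[:c:] ^ i = [:c ^ i:]" for c :: "'a :: comm_semiring_1"
  by (induction i) (auto simp: one_pCons mult.commute)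

text \<open>In this encoding \<open>[:[:-1, 1:]:]\<close> is x - 1, constant in y, and
  \<open>[:[:-1:], 1:]\<close> is y - 1, so the two factors contribute to the x- and y-exponents
  separately.\<close>

lemma coeff_tutte_term:
  "coeff (coeff ([:[:-1, 1:]:] ^ i * [:[:-1:], 1:] ^ j) b) a
    = coeff ([:-1, 1:] ^ i) a * (int (j choose b) * (-1) ^ (j - b))"
proof (cases "b \<le> j")
  case True
  have "coeff ([:[:-1 :: int:], 1:] ^ j) b = [:int (j choose b) * (-1) ^ (j - b):]"
    by (simp add: coeff_linear_poly_power[OF True] const_poly_power of_nat_poly)
  then show ?thesis by (simp add: const_poly_power mult.commute)
next
  case False
  have "degree ([:[:-1 :: int:], 1:] ^ j) \<le> j"
    using degree_power_le[of "[:[:-1 :: int:], 1:]" j] by simp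
  then have "coeff ([:[:-1 :: int:], 1:] ^ j) b = 0" using False by (intro coeff_eq_0) simp
  then show ?thesis using False by (simp add: const_poly_power)
qed

lemma ncomp_empty: "ncomp V ends {} = card V"
proof -
  have "conn V ends {} `` {v} = {v}" if "v \<in> V" for v
    using that by (auto simp: conn_def edge_rel_def)
  then have "V // conn V ends {} = (\<lambda>v. {v}) ` V"
    unfolding quotient_def UNION_singleton_eq_range by (rule image_cong[OF refl])
  then show ?thesis by (simp add: ncomp_def card_image)
qed

lemma ncomp_le_card: "finite V \<Longrightarrow> ncomp V ends A \<le> card V"
  unfolding ncomp_def quotient_def UNION_singleton_eq_range by (rule card_image_le)

section \<open>Expansion of the Tutte polynomial by dual rank\<close>

context bridgeless_graph
begin

text \<open>Duality exchanges the two exponents: the nullity of \<open>C\<close> in the dual is the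
  corank of its complement in the graph, and vice versa.\<close>

lemma tutte_eq_dual:
  assumes conn: "ncomp V ends E = 1"
  defines "R \<equiv> card E + 1 - card V"
  shows "tutte V E ends = (\<Sum>C\<in>Pow E. [:[:-1, 1:]:] ^ (card C - dual_rank V E ends C)
      * [:[:-1:], 1:] ^ (R - dual_rank V E ends C))"
  unfolding tutte_def
proof (rule sum.reindex_bij_witness[of _ "\<lambda>C. E - C" "\<lambda>A. E - A"])
  fix A assume "A \<in> Pow E"
  then have A: "A \<subseteq> E" "E - (E - A) = A" by auto
  have fin: "finite V" "finite E" using multigraph_finite[OF graph] .
  have "card (E - A) = card E - card A" "card A \<le> card E"
    using A fin by (auto simp: card_Diff_subset finite_subset card_mono)
  moreover have "dual_rank V E ends (E - A) + ncomp V ends A = card (E - A) + 1"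
    using dual_rank_eq[OF graph, of "E - A"] A conn by simp
  moreover have "ncomp V ends A \<le> card V" using ncomp_le_card[OF fin(1)] .
  moreover have "1 \<le> card V" using ncomp_le_card[OF fin(1), of ends E] conn by simp
  ultimately have "card (E - A) - dual_rank V E ends (E - A) = grank V ends E - grank V ends A"
    "R - dual_rank V E ends (E - A) = gnullity V ends A"
    using conn by (auto simp: grank_def gnullity_def R_def)
  then show "[:[:-1, 1:]:] ^ (card (E - A) - dual_rank V E ends (E - A))
      * [:[:-1:], 1:] ^ (R - dual_rank V E ends (E - A))
    = [:[:-1, 1:]:] ^ (grank V ends E - grank V ends A) * [:[:-1:], 1:] ^ gnullity V ends A"
    by simp
qed auto

lemma card_V_le:
  assumes "ncomp V ends E = 1"
  shows "card V \<le> card E + 1"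
  using ncomp_Diff_le[OF graph, of E] assms by (simp add: ncomp_empty)

text \<open>The bound is the rank of the whole ground set, because deleting all edges leaves
  \<open>card V\<close> components.\<close>

lemma dual_rank_le:
  assumes "ncomp V ends E = 1" "C \<subseteq> E"
  shows "dual_rank V E ends C \<le> card E + 1 - card V"
  using dual.rank_mono[OF assms(2)] dual_rank_eq[OF graph, of E] assms(1) by (simp add: ncomp_empty)

text \<open>The coefficient of y^(R - j) in (y - 1)^(R - i) vanishes for i > j, so only sets of rank
  at most \<open>j\<close> contribute.\<close>

lemma tcoef_tutte:
  assumes conn: "ncomp V ends E = 1"
  defines "R \<equiv> card E + 1 - card V"
  shows "tcoef (tutte V E ends) (int a) (int R - int j)
    = (\<Sum>i\<le>j. (-1) ^ (j - i) * int (R - i choose (j - i)) * dual.rank_coeff i a)"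
proof (cases "j \<le> R")
  case False
  \<comment> \<open>The y-exponent is negative here and \<open>tcoef\<close> returns its default 0.
    The right-hand side agrees: either \<open>j - i\<close> exceeds \<open>R - i\<close>, or no set
    has rank \<open>i\<close>.\<close>
  have "(R - i choose (j - i)) = 0 \<or> dual.rank_coeff i a = 0" if "i \<le> j" for i
  proof (cases "i \<le> R")
    case False
    have none: "{C. C \<subseteq> E \<and> dual_rank V E ends C = i} = {}"
      using dual_rank_le[OF conn] False unfolding R_def by fastforce
    show ?thesis unfolding dual.rank_coeff_def none by simp
  qed (use \<open>\<not> j \<le> R\<close> in \<open>auto intro: binomial_eq_0\<close>)
  then have "(\<Sum>i\<le>j. (-1) ^ (j - i) * int (R - i choose (j - i)) * dual.rank_coeff i a) = 0"
    by (intro sum.neutral) auto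
  moreover have "int R - int j < 0" using False by simp
  ultimately show ?thesis by (simp add: tcoef_def)
next
  case True
  let ?r = "dual_rank V E ends"
  let ?c = "\<lambda>C. coeff ([:-1, 1:] ^ (card C - ?r C)) a :: int"
  let ?w = "\<lambda>i. (-1) ^ (j - i) * int (R - i choose (j - i))"
  \<comment> \<open>Symmetry of the binomial gives the lower index \<open>j - i\<close>, which is at
    most two in the application, while \<open>R\<close> is arbitrary.\<close>
  have w: "int (R - i choose (R - j)) * (-1) ^ (R - i - (R - j)) = (if i \<le> j then ?w i else 0)"
    if "i \<le> R" for i
  proof (cases "i \<le> j")
    case le: True
    have "(R - i choose (j - i)) = (R - i choose (R - j))"
      using binomial_symmetric[of "j - i" "R - i"] True le by simp
    moreover have "R - i - (R - j) = j - i" using True le by simp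
    ultimately show ?thesis using le by simp
  qed (use True that in \<open>auto intro: binomial_eq_0\<close>)
  have "tcoef (tutte V E ends) (int a) (int R - int j) = coeff (coeff (tutte V E ends) (R - j)) a"
    using True by (simp add: tcoef_def nat_diff_distrib flip: of_nat_diff)
  also have "\<dots> = (\<Sum>C\<in>Pow E. ?c C * (int (R - ?r C choose (R - j)) * (-1) ^ (R - ?r C - (R - j))))"
    unfolding tutte_eq_dual[OF conn] R_def[symmetric] coeff_sum coeff_tutte_term ..
  also have "\<dots> = (\<Sum>C\<in>Pow E. if ?r C \<le> j then ?w (?r C) * ?c C else 0)"
  proof (rule sum.cong[OF refl])
    fix C assume "C \<in> Pow E"
    then have "?r C \<le> R" using dual_rank_le[OF conn] unfolding R_def by blast
    then show "?c C * (int (R - ?r C choose (R - j)) * (-1) ^ (R - ?r C - (R - j)))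
        = (if ?r C \<le> j then ?w (?r C) * ?c C else 0)"
      unfolding w[OF \<open>?r C \<le> R\<close>] by simp
  qed
  also have "\<dots> = (\<Sum>C | C \<in> Pow E \<and> ?r C \<le> j. ?w (?r C) * ?c C)"
    by (rule sum.inter_filter[symmetric]) (simp add: dual.finite_ground)
  also have "\<dots> = (\<Sum>i\<le>j. \<Sum>C | C \<in> {C. C \<in> Pow E \<and> ?r C \<le> j} \<and> ?r C = i. ?w (?r C) * ?c C)"
    by (rule sum.group[symmetric]) (auto simp: dual.finite_ground)
  also have "\<dots> = (\<Sum>i\<le>j. ?w i * dual.rank_coeff i a)"
  proof (rule sum.cong[OF refl])
    fix i assume "i \<in> {..j}"
    then have "{C. C \<in> {C. C \<in> Pow E \<and> ?r C \<le> j} \<and> ?r C = i} = {C. C \<subseteq> E \<and> ?r C = i}" by auto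
    then show "(\<Sum>C | C \<in> {C. C \<in> Pow E \<and> ?r C \<le> j} \<and> ?r C = i. ?w (?r C) * ?c C)
        = ?w i * dual.rank_coeff i a"
      unfolding dual.rank_coeff_def sum_distrib_left by (auto intro: sum.cong)
  qed
  finally show ?thesis .
qed

end

theorem theorem1:
  fixes V :: "'v set" and E :: "'e set" and ends :: "'e \<Rightarrow> 'v set"
  assumes "multigraph V E ends" and "loopless E ends"
    and "connected_graph V E ends" and "bridgeless V E ends"
  defines "n \<equiv> int (card V)" and "m \<equiv> int (card E)"
    and "T \<equiv> tutte V E ends"
    and "s \<equiv> int (num_series V E ends)"
    and "s' \<equiv> int (num_nontriv_series V E ends)"
    and "th \<equiv> int (num_theta V E ends)"
  shows "tcoef T 0 (m - n + 1) = 1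
       \<and> tcoef T 0 (m - n) = n + s - m - 1
       \<and> tcoef T 0 (m - n - 1) =
           int (nat (m - n + 1) choose 2) - (m - n) * s + int (num_series V E ends choose 2) - th
       \<and> tcoef T 1 (m - n) = s'
       \<and> tcoef T 1 (m - n - 1) =
           - s' * (m - n)
           + (\<Sum>A\<in>{C. series_class V E ends C \<and> card C \<ge> 2}. int (num_series V (E - A) ends))
           + th"
proof -
  interpret bridgeless_graph V E ends using assms(1,4) by unfold_locales
  have conn: "ncomp V ends E = 1" using assms(3) by (simp add: connected_graph_def)
  define R where "R = card E + 1 - card V"
  have R: "m - n + 1 = int R" "m - n = int R - int 1" "m - n - 1 = int R - int 2"
    using card_V_le[OF conn] by (auto simp: m_def n_def R_def)
  have s: "s = int (card {P. dual.flat 1 P})"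
    by (simp add: s_def num_series_def series_class_iff)
  have s': "s' = int (card {P. dual.flat 1 P \<and> 2 \<le> card P})"
    by (simp add: s'_def num_nontriv_series_def series_class_iff)
  have th: "th = int (card {F. dual.flat 2 F \<and> card (dual.points F) = 3})"
    by (simp add: th_def num_theta_def theta_class_iff[OF conn])
  note le3 = card_points_le_3[OF conn]
  have rc10: "dual.rank_coeff 1 0 = s" unfolding s by (rule dual.rank_coeff_1_0)
  have rc11: "dual.rank_coeff 1 1 = s'" unfolding s' by (rule dual.rank_coeff_1_1)
  have rc20: "dual.rank_coeff 2 0 = int (num_series V E ends choose 2) - th"
    using dual.rank_coeff_2_0[OF le3] unfolding th num_series_def series_class_iff by simp
  have "(\<Sum>A\<in>{C. series_class V E ends C \<and> card C \<ge> 2}. int (num_series V (E - A) ends))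
      = (\<Sum>A | dual.flat 1 A \<and> 2 \<le> card A. int (card {F. dual.flat 2 F \<and> A \<subseteq> F}))"
    unfolding series_class_iff by (rule sum.cong) (use num_series_Diff in auto)
  then have rc21: "dual.rank_coeff 2 1
      = (\<Sum>A\<in>{C. series_class V E ends C \<and> card C \<ge> 2}. int (num_series V (E - A) ends)) + th"
    using dual.rank_coeff_2_1[OF le3] unfolding th by simp
  \<comment> \<open>For \<open>R = 0\<close> the natural number \<open>R - 1\<close> is 0 although
    \<open>m - n\<close> is -1. The two products still agree, since there are no series classes
    then.\<close>
  have "{P. dual.flat 1 P} = {}" if "R = 0"
    using dual_rank_le[OF conn] that by (auto simp: dual.flat_def R_def)
  then have R1: "int (R - 1) * s = (m - n) * s" "int (R - 1) * s' = (m - n) * s'"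
    unfolding R s s' by (cases "R = 0"; simp)+
  have c: "tcoef T 0 (int R - int j) = (\<Sum>i\<le>j. (-1) ^ (j - i) * int (R - i choose (j - i)) * dual.rank_coeff i 0)"
    "tcoef T 1 (int R - int j) = (\<Sum>i\<le>j. (-1) ^ (j - i) * int (R - i choose (j - i)) * dual.rank_coeff i 1)"
    for j
    using tcoef_tutte[OF conn, of 0 j] tcoef_tutte[OF conn, of 1 j] by (auto simp: R_def T_def)
  have "tcoef T 0 (m - n + 1) = 1"
    using c(1)[of 0] by (simp add: R dual.rank_coeff_0)
  moreover have "tcoef T 0 (m - n) = s - int R"
    unfolding R(2) c using rc10 by (simp add: dual.rank_coeff_0)
  moreover have "tcoef T 1 (m - n) = s'"
    unfolding R(2) c using rc11 dual.rank_coeff_0(2) by simp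
  moreover have "tcoef T 0 (m - n - 1) = int (R choose 2) - int (R - 1) * s + dual.rank_coeff 2 0"
    unfolding R(3) c using rc10 by (simp add: dual.rank_coeff_0 numeral_2_eq_2)
  moreover have "tcoef T 1 (m - n - 1) = - (int (R - 1) * s') + dual.rank_coeff 2 1"
    unfolding R(3) c using rc11 dual.rank_coeff_0(2) by (simp add: numeral_2_eq_2)
  moreover have "nat (m - n + 1) = R" using R(1) by simp
  ultimately show ?thesis
    unfolding rc20 rc21 R1 using R(1) by (simp add: algebra_simps)
qed

end
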